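(* Let $K$ be a totally real number field with ring of integers $\mathcal O$, and let $\mathcal O^+$ be the set of totally positive elements of $\mathcal O$. For every $\delta\in\mathcal O^+$ and every $m\in\mathbb Z^+$, the number $p(\succeq,m,\delta)$ of chain partitions of $\delta$ with at most $m$ parts is equal to the number of solutions $(x_1,\ldots,x_m)$ to $$\delta=x_1+2x_2+\cdots+mx_m$$ with $x_i\in\mathcal O^+\cup\{0\}$ for all $i$. As a consequence, as formal power $q$-sums, $$\sum_{\delta\in\mathcal O^+\cup\{0\}}p(\succeq,\delta)q^{\delta}=\prod_{m=1}^{\infty}\left(\sum_{\alpha\in\mathcal O^+\cup\{0\}}q^{m\alpha}\right).$$
   Context: An element of $\mathcal O$ is totally positive if all its images under the embeddings $K\to\mathbb R$ are positive. Write $\alpha\succeq0$ if $\alpha\in\mathcal O^+\cup\{0\}$. A partition of $\delta\in\mathcal O^+$ is a finite sequence $(\lambda_1,\ldots,\lambda_r)$ (with $r$ not fixed) of elements of $\mathcal O^+$, called its parts, with $\lambda_1+\cdots+\lambda_r=\delta$; two partitions are identified if one is a reordering of the other. A chain partition of $\delta$ is a partition which can be written as $(\lambda_1,\ldots,\lambda_r)$ with $\lambda_{i+1}-\lambda_i\succeq0$ for all $i=1,\ldots,r-1$ (equivalently, chain partitions of $\delta$ correspond to sequences $(\lambda_1,\ldots,\lambda_r)$ in $\mathcal O^+$ with sum $\delta$ and $\lambda_{i+1}-\lambda_i\succeq 0$ for all $i<r$). For $\delta\in\mathcal O^+$, $p(\succeq,\delta)$ is the number of chain partitions of $\delta$,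 and $p(\succeq,m,\delta)$ is the number of chain partitions of $\delta$ with at most $m$ parts. By convention $p(\succeq,0)=1$ (empty partition). Formal power $q$-sums: these are formal expressions $\sum_{\delta\in\mathcal O^+\cup\{0\}}c_\delta q^\delta$ with $c_\delta\in\mathbb R$ (no convergence is required), i.e. functions $\delta\mapsto c_\delta$ on $\mathcal O^+\cup\{0\}$. They are added coefficientwise and multiplied by $\left(\sum c_\delta q^\delta\right)\left(\sum d_\delta q^\delta\right)=\sum_{\gamma}\left(\sum_{\gamma=\alpha+\beta}c_\alpha d_\beta\right)q^\gamma$ with $\alpha,\beta\in\mathcal O^+\cup\{0\}$; the inner sum is finite because each $\gamma$ has only finitely many decompositions $\gamma=\alpha+\beta$ with $\alpha,\beta\in\mathcal O^+\cup\{0\}$. An infinite product $\prod_{i\in I}f_i(q)$ is defined as $\sum c_\delta q^\delta$ if for each $\delta\in\mathcal O^+\cup\{0\}$ there is a finite $I_\delta\subset I$ such that for every finite $J$ with $I_\delta\subset J\subset I$ the coefficient of $q^\delta$ in $\prod_{i\in J}f_i(q)$ equals that in $\prod_{i\in I_\delta}f_i(q)$; this common value is $c_\delta$. *)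

theory Defs
  imports
    Complex_Main
    "HOL-Library.Multiset"
    "HOL-Library.FuncSet"
    "HOL-Library.Indicator_Function"
    "HOL-Computational_Algebra.Polynomial"
begin

text \<open>
  A number field is a type \<open>'k\<close> of characteristic 0 that is finite-dimensional
  over the rationals; its ring of integers is the set of its algebraic integers.
\<close>

definition number_field :: "'k::field_char_0 itself \<Rightarrow> bool" where
  "number_field _ \<longleftrightarrow>
     (\<exists>B. finite_dimensional_vector_space (\<lambda>(q::rat) (x::'k). of_rat q * x) B)"

definition field_embedding :: "('k::field \<Rightarrow> 'l::field) \<Rightarrow> bool" where
  "field_embedding \<sigma> \<longleftrightarrow>
     \<sigma> 1 = 1 \<and> (\<forall>x y. \<sigma> (x + y) = \<sigma> x + \<sigma> y) \<and> (\<forall>x y. \<sigma> (x * y) = \<sigma> x * \<sigma> y)"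

definition totally_real :: "'k::field_char_0 itself \<Rightarrow> bool" where
  "totally_real _ \<longleftrightarrow> (\<forall>\<sigma> :: 'k \<Rightarrow> complex. field_embedding \<sigma> \<longrightarrow> range \<sigma> \<subseteq> \<real>)"

definition ring_of_integers :: "'k::field_char_0 set" where
  "ring_of_integers = {x. algebraic_int x}"

definition totally_positive :: "'k::field_char_0 \<Rightarrow> bool" where
  "totally_positive x \<longleftrightarrow> (\<forall>\<sigma> :: 'k \<Rightarrow> real. field_embedding \<sigma> \<longrightarrow> \<sigma> x > 0)"

definition tp_integers :: "'k::field_char_0 set" where
  "tp_integers = {x \<in> ring_of_integers. totally_positive x}"

definition tp_integers0 :: "'k::field_char_0 set" where
  "tp_integers0 = tp_integers \<union> {0}"

text \<open>
  Sequences up to reordering are multisets. In a totally real number field the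
  only partition of 0 is the empty one, which is a chain partition, so the
  convention \<open>num_chain_partitions 0 = 1\<close> is built in.
\<close>

definition partitions :: "'k::field_char_0 \<Rightarrow> 'k multiset set" where
  "partitions \<delta> = {P. set_mset P \<subseteq> tp_integers \<and> sum_mset P = \<delta>}"

definition chain_partitions :: "'k::field_char_0 \<Rightarrow> 'k multiset set" where
  "chain_partitions \<delta> =
     {P \<in> partitions \<delta>. \<exists>xs. mset xs = P \<and> successively (\<lambda>x y. y - x \<in> tp_integers0) xs}"

definition num_chain_partitions :: "'k::field_char_0 \<Rightarrow> nat" where
  "num_chain_partitions \<delta> = card (chain_partitions \<delta>)"

definition num_chain_partitions_upto :: "nat \<Rightarrow> 'k::field_char_0 \<Rightarrow> nat" where
  "num_chain_partitions_upto m \<delta> = card {P \<in> chain_partitions \<delta>. size P \<le> m}"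

text \<open>
  A formal power q-sum is represented by its coefficient function, of which only
  the values on \<^const>\<open>tp_integers0\<close> are relevant. In a totally real number field
  the index set of the sum in \<open>qsum_mult\<close> is finite.
\<close>

type_synonym 'k qsum = "'k \<Rightarrow> real"

definition qsum_one :: "'k::field_char_0 qsum" where
  "qsum_one = indicator {0}"

definition qsum_mult :: "'k::field_char_0 qsum \<Rightarrow> 'k qsum \<Rightarrow> 'k qsum" where
  "qsum_mult c d =
     (\<lambda>\<gamma>. \<Sum>(\<alpha>, \<beta>) \<in> {(\<alpha>, \<beta>). \<alpha> \<in> tp_integers0 \<and> \<beta> \<in> tp_integers0 \<and> \<gamma> = \<alpha> + \<beta>}. c \<alpha> * d \<beta>)"

definition qsum_prod :: "('i \<Rightarrow> 'k::field_char_0 qsum) \<Rightarrow> 'i set \<Rightarrow> 'k qsum" where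
  "qsum_prod f J = Finite_Set.fold (\<lambda>i. qsum_mult (f i)) qsum_one J"

definition has_qsum_prod :: "('i \<Rightarrow> 'k::field_char_0 qsum) \<Rightarrow> 'i set \<Rightarrow> 'k qsum \<Rightarrow> bool" where
  "has_qsum_prod f I c \<longleftrightarrow>
     (\<forall>\<delta> \<in> tp_integers0. \<exists>I\<^sub>\<delta>. finite I\<^sub>\<delta> \<and> I\<^sub>\<delta> \<subseteq> I \<and>
        (\<forall>J. finite J \<and> I\<^sub>\<delta> \<subseteq> J \<and> J \<subseteq> I \<longrightarrow> qsum_prod f J \<delta> = qsum_prod f I\<^sub>\<delta> \<delta>) \<and>
        c \<delta> = qsum_prod f I\<^sub>\<delta> \<delta>)"

text \<open>
  The q-sum of all \<open>q\<close> to the power \<open>m\<alpha>\<close> with \<open>\<alpha>\<close> in \<^const>\<open>tp_integers0\<close>. For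
  \<open>m \<ge> 1\<close> the exponents \<open>m\<alpha>\<close> are pairwise distinct, hence all coefficients are 0 or 1.
\<close>

definition multiples_qsum :: "nat \<Rightarrow> 'k::field_char_0 qsum" where
  "multiples_qsum m = indicator ((\<lambda>\<alpha>. of_nat m * \<alpha>) ` tp_integers0)"

end

theory Submission
  imports
    Defs
    "HOL-Computational_Algebra.Fundamental_Theorem_Algebra"
    "Jordan_Normal_Form.Char_Poly"
begin

text \<open>
  Write \<open>\<alpha> \<preceq> \<beta>\<close> if \<open>\<beta> - \<alpha>\<close> is totally positive or zero. A chain partition with at most
  \<open>m\<close> parts, padded with zeros at its lower end, is a chain \<open>y\<^sub>0 \<preceq> \<dots> \<preceq> y\<^bsub>m-1\<^esub>\<close> of exactly
  \<open>m\<close> terms. It is the same thing as the sequence of its increments \<open>x\<^sub>m = y\<^sub>0\<close> and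
  \<open>x\<^bsub>m-j\<^esub> = y\<^sub>j - y\<^bsub>j-1\<^esub>\<close>, and the increment \<open>x\<^sub>i\<close> is contained in the last \<open>i\<close> terms, so
  that the sum of the chain is \<open>x\<^sub>1 + 2 x\<^sub>2 + \<dots> + m x\<^sub>m\<close>: this is conjugation of Young
  diagrams (\<open>bij_betw_tails\<close>, \<open>bij_betw_chain_lists_partitions\<close>). On the other side,
  expanding a finite product of the q-sums over \<open>m \<in> J\<close> counts the solutions of
  \<open>\<delta> = \<Sum>i\<in>J. i x\<^sub>i\<close> (\<open>qsum_prod_multiples\<close>), and the infinite product is reached because
  all unknowns \<open>x\<^sub>i\<close> with large \<open>i\<close> vanish.

  The combinatorics rests on three properties of the totally positive integers: they are closed
  under addition, they do not contain 0, and only finitely many of them lie below a given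
  \<open>\<gamma>\<close> (\<open>finite_tp_interval\<close>). The last one also bounds the number of parts of a partition
  of \<open>\<gamma>\<close>. Closure under addition comes from the determinant argument for algebraic integers.
  That 0 is excluded means that a real embedding exists at all.

  Finiteness: there are finitely many embeddings, and if two integers between 0 and \<open>\<gamma>\<close> have
  the same integer part under each of them, then all conjugates of their difference \<open>b\<close> are
  smaller than 1 in absolute value. Such an algebraic integer is zero
  (\<open>algebraic_int_eq_0_if_conjugates_small\<close>): the coordinates of \<open>b\<^sup>k\<close> in a rational basis
  have bounded denominators, and they tend to 0, so \<open>b\<^sup>k = 0\<close> for some \<open>k\<close>.

  Embeddings are obtained without extending them along a tower of fields. The field \<open>K\<close> acts on
  the additive functions \<open>f : K \<rightarrow> \<complex>\<close> by \<open>(a f)(x) = f (a x)\<close>. These operators commute and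
  each satisfies a polynomial equation, so that there is a common eigenfunction \<open>f\<close>; its
  eigenvalues \<open>\<sigma>(a) = f a / f 1\<close> form an embedding (\<open>embedding_from_additive\<close>). Hence every
  eigenvalue of multiplication by \<open>b\<close> is a conjugate of \<open>b\<close>, and this is also why the
  coordinates of \<open>b\<^sup>k\<close> tend to 0 when all conjugates are small.
\<close>

section \<open>Sums of algebraic integers\<close>

text \<open>
  The numbers \<open>v \<in> V\<close> are the entries of an eigenvector, with eigenvalue \<open>z\<close>, of an
  integer matrix; the characteristic polynomial of that matrix is monic and vanishes at \<open>z\<close>.
\<close>
lemma algebraic_int_if_stable:
  fixes z :: "'a::field_char_0"
  assumes V: "finite V" "v \<in> V" "v \<noteq> 0"
    and stable: "\<And>v. v \<in> V \<Longrightarrow> \<exists>c. z * v = (\<Sum>w\<in>V. of_int (c w) * w)"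
  shows "algebraic_int z"
proof -
  obtain c where c: "\<And>v. v \<in> V \<Longrightarrow> z * v = (\<Sum>w\<in>V. of_int (c v w) * w)"
    using stable by metis
  define n where "n = card V"
  obtain e where e: "bij_betw e {0..<n} V"
    using ex_bij_betw_nat_finite[OF V(1)] unfolding n_def by blast
  define A :: "int mat" where "A = mat n n (\<lambda>(i, j). c (e i) (e j))"
  define u where "u = vec n e"
  have A: "A \<in> carrier_mat n n" by (simp add: A_def)
  have hom: "(map_mat of_int A :: 'a mat) \<in> carrier_mat n n" by (simp add: A_def)
  have "map_mat of_int A *\<^sub>v u = z \<cdot>\<^sub>v u"
  proof (rule eq_vecI)
    fix i assume "i < dim_vec (z \<cdot>\<^sub>v u)"
    hence i: "i < n" by (simp add: u_def)
    hence "(map_mat of_int A *\<^sub>v u) $ i = (\<Sum>j = 0..<n. of_int (c (e i) (e j)) * e j)"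
      by (simp add: A_def u_def scalar_prod_def)
    also have "\<dots> = (\<Sum>w\<in>V. of_int (c (e i) w) * w)"
      by (rule sum.reindex_bij_betw[OF e])
    also have "\<dots> = z * e i" using c[of "e i"] bij_betwE[OF e] i by simp
    finally show "(map_mat of_int A *\<^sub>v u) $ i = (z \<cdot>\<^sub>v u) $ i" using i by (simp add: u_def)
  qed (simp add: A_def u_def)
  moreover have "u \<noteq> 0\<^sub>v n"
  proof
    assume u: "u = 0\<^sub>v n"
    obtain i where i: "i < n" "e i = v" using e V(2) unfolding bij_betw_def by force
    hence "u $ i = v" by (simp add: u_def)
    with u i V(3) show False by simp
  qed
  ultimately have "eigenvalue (map_mat of_int A) z"
    unfolding eigenvalue_def eigenvector_def using A by (intro exI[of _ u]) (auto simp: u_def)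
  hence "poly (map_poly of_int (char_poly A)) z = 0"
    using eigenvalue_root_char_poly[OF hom] by (simp add: of_int_hom.char_poly_hom[OF A])
  moreover have "lead_coeff (char_poly A) = 1"
    using degree_monic_char_poly[OF A] by auto
  ultimately show ?thesis unfolding algebraic_int_altdef_ipoly by blast
qed

lemma algebraic_int_power_reduction:
  fixes x :: "'a::field_char_0"
  assumes "algebraic_int x"
  obtains m c where "m > 0" "x ^ m = (\<Sum>i<m. of_int (c i) * x ^ i)"
proof -
  obtain p where p: "poly (map_poly of_int p) x = 0" "lead_coeff p = 1"
    using assms unfolding algebraic_int_altdef_ipoly by blast
  define m where "m = degree p"
  have "m \<noteq> 0"
  proof
    assume "m = 0"
    then obtain a where "p = [:a:]" by (auto simp: m_def elim: degree_eq_zeroE)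
    with p show False by simp
  qed
  have "0 = (\<Sum>i\<le>m. of_int (coeff p i) * x ^ i)"
    using p(1) by (simp add: poly_altdef m_def)
  also have "{..m} = insert m {..<m}" by auto
  also have "(\<Sum>i\<in>insert m {..<m}. of_int (coeff p i) * x ^ i) = x ^ m + (\<Sum>i<m. of_int (coeff p i) * x ^ i)"
    using p(2) by (simp add: m_def)
  finally have "x ^ m = (\<Sum>i<m. of_int (- coeff p i) * x ^ i)"
    by (simp add: sum_negf eq_neg_iff_add_eq_0)
  with \<open>m \<noteq> 0\<close> that[of m "\<lambda>i. - coeff p i"] show ?thesis by simp
qed

text \<open>
  If \<open>x\<close> and \<open>y\<close> satisfy monic equations of degrees \<open>m\<close> and \<open>n\<close>, the integer
  span of the monomials \<open>x\<^sup>i y\<^sup>j\<close> with \<open>i < m\<close> and \<open>j < n\<close> is stable under multiplication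
  by both of them.
\<close>
lemma algebraic_int_add:
  fixes x y :: "'a::field_char_0"
  assumes "algebraic_int x" "algebraic_int y"
  shows "algebraic_int (x + y)"
proof -
  interpret int: Modules.module "\<lambda>(c::int) (v::'a). of_int c * v"
    by standard (simp_all add: algebra_simps)
  obtain m a where m: "m > 0" "x ^ m = (\<Sum>i<m. of_int (a i) * x ^ i)"
    using assms(1) by (rule algebraic_int_power_reduction)
  obtain n b where n: "n > 0" "y ^ n = (\<Sum>j<n. of_int (b j) * y ^ j)"
    using assms(2) by (rule algebraic_int_power_reduction)
  define V where "V = (\<lambda>(i, j). x ^ i * y ^ j) ` ({..<m} \<times> {..<n})"
  have V: "x ^ i * y ^ j \<in> V" if "i < m" "j < n" for i j
    using that by (auto simp: V_def)
  have fin: "finite V" by (simp add: V_def)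
  have x: "x ^ Suc i * y ^ j \<in> int.span V" if "i < m" "j < n" for i j
  proof (cases "Suc i = m")
    case True
    hence "x ^ Suc i * y ^ j = (\<Sum>k<m. of_int (a k) * (x ^ k * y ^ j))"
      using m(2) by (simp del: power_Suc add: sum_distrib_right mult.assoc)
    also have "\<dots> \<in> int.span V"
      using V that by (intro int.span_sum int.span_scale int.span_base) auto
    finally show ?thesis .
  qed (use that V in \<open>auto intro!: int.span_base simp del: power_Suc\<close>)
  have y: "x ^ i * y ^ Suc j \<in> int.span V" if "i < m" "j < n" for i j
  proof (cases "Suc j = n")
    case True
    hence "x ^ i * y ^ Suc j = (\<Sum>k<n. of_int (b k) * (x ^ i * y ^ k))"
      using n(2) by (simp del: power_Suc add: sum_distrib_left mult.left_commute)
    also have "\<dots> \<in> int.span V"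
      using V that by (intro int.span_sum int.span_scale int.span_base) auto
    finally show ?thesis .
  qed (use that V in \<open>auto intro!: int.span_base simp del: power_Suc\<close>)
  have "(x + y) * v \<in> int.span V" if v: "v \<in> V" for v
  proof -
    from v obtain i j where ij: "i < m" "j < n" "v = x ^ i * y ^ j" by (auto simp: V_def)
    hence "(x + y) * v = x ^ Suc i * y ^ j + x ^ i * y ^ Suc j" by (simp add: algebra_simps)
    with x y ij show ?thesis by (auto intro: int.span_add simp del: power_Suc)
  qed
  hence "\<exists>c. (x + y) * v = (\<Sum>w\<in>V. of_int (c w) * w)" if "v \<in> V" for v
    using that int.span_finite[OF fin] by blast
  moreover have "x ^ 0 * y ^ 0 \<in> V" using m(1) n(1) by (rule V)
  ultimately show ?thesis using algebraic_int_if_stable[OF fin, of 1] by simp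
qed

section \<open>Eigenfunctions of multiplication operators\<close>

text \<open>
  This is \<open>p(T) f\<close>, where \<open>T\<close> is the operator that sends \<open>f\<close> to \<open>\<lambda>x. f (b * x)\<close>.
\<close>
definition apply_poly :: "complex poly \<Rightarrow> 'a::comm_ring_1 \<Rightarrow> ('a \<Rightarrow> complex) \<Rightarrow> 'a \<Rightarrow> complex" where
  "apply_poly p b f x = (\<Sum>i\<le>degree p. coeff p i * f (b ^ i * x))"

lemma apply_poly_altdef:
  assumes "degree p \<le> n"
  shows "apply_poly p b f x = (\<Sum>i\<le>n. coeff p i * f (b ^ i * x))"
  unfolding apply_poly_def using assms
  by (intro sum.mono_neutral_left) (auto intro: le_degree)

text \<open>
  In operator notation, \<open>((T - \<mu>) q(T)) f = q(T) (T f - \<mu> f)\<close>.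
\<close>
lemma apply_poly_linear_factor:
  "apply_poly ([:-\<mu>, 1:] * q) b f x = apply_poly q b (\<lambda>y. f (b * y) - \<mu> * f y) x"
proof -
  define n where "n = degree q"
  have deg: "degree ([:-\<mu>, 1:] * q) \<le> Suc n"
    using degree_mult_le[of "[:-\<mu>, 1:]" q] by (simp add: n_def)
  have "apply_poly ([:-\<mu>, 1:] * q) b f x =
      (\<Sum>i\<le>Suc n. (coeff (pCons 0 q) i - \<mu> * coeff q i) * f (b ^ i * x))"
    by (subst apply_poly_altdef[OF deg]) (simp del: sum.atMost_Suc)
  also have "\<dots> = (\<Sum>i\<le>Suc n. coeff (pCons 0 q) i * f (b ^ i * x))
      - \<mu> * (\<Sum>i\<le>Suc n. coeff q i * f (b ^ i * x))"
    unfolding left_diff_distrib sum_subtractf by (simp del: sum.atMost_Suc add: sum_distrib_left mult.assoc)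
  also have "(\<Sum>i\<le>Suc n. coeff (pCons 0 q) i * f (b ^ i * x)) =
      (\<Sum>i\<le>n. coeff q i * f (b ^ i * (b * x)))"
    by (subst sum.atMost_Suc_shift) (simp add: algebra_simps)
  also have "(\<Sum>i\<le>Suc n. coeff q i * f (b ^ i * x)) = (\<Sum>i\<le>n. coeff q i * f (b ^ i * x))"
    by (simp add: n_def coeff_eq_0)
  also have "(\<Sum>i\<le>n. coeff q i * f (b ^ i * (b * x))) - \<mu> * (\<Sum>i\<le>n. coeff q i * f (b ^ i * x)) =
      apply_poly q b (\<lambda>y. f (b * y) - \<mu> * f y) x"
    unfolding apply_poly_def n_def
    by (simp add: sum_distrib_left algebra_simps flip: sum_subtractf)
  finally show ?thesis .
qed

text \<open>
  In operator notation, \<open>q(T)\<close> commutes with \<open>T - \<mu>\<close>.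
\<close>
lemma apply_poly_shift:
  "apply_poly q b (\<lambda>y. f (b * y) - \<mu> * f y) x = apply_poly q b f (b * x) - \<mu> * apply_poly q b f x"
  unfolding apply_poly_def by (simp add: sum_distrib_left algebra_simps flip: sum_subtractf)

lemma additive_apply_poly:
  assumes "additive f"
  shows "additive (apply_poly p b f)"
  by standard (simp add: apply_poly_def additive.add[OF assms] distrib_left sum.distrib)

lemma additive_of_int_mult:
  fixes f :: "'a::ring_1 \<Rightarrow> 'b::ring_1"
  assumes "additive f"
  shows "f (of_int c * x) = of_int c * f x"
proof (induction c rule: int_induct[of _ 0])
  case base
  then show ?case by (simp add: additive.zero[OF assms])
qed (simp_all add: algebra_simps additive.add[OF assms] additive.diff[OF assms])

text \<open>
  An integer equation for \<open>b\<close> is thus an equation \<open>p(T) f = 0\<close> for every additive \<open>f\<close>.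
\<close>
lemma apply_poly_of_int:
  fixes f :: "'a::field_char_0 \<Rightarrow> complex"
  assumes "additive f"
  shows "apply_poly (map_poly of_int p) b f x = f (poly (map_poly of_int p) b * x)"
proof -
  have "poly (map_poly of_int p) b * x = (\<Sum>i\<le>degree p. of_int (coeff p i) * (b ^ i * x))"
    by (subst poly_altdef)
       (simp_all add: sum_distrib_right mult.assoc degree_map_poly coeff_map_poly)
  thus ?thesis
    by (simp add: apply_poly_altdef[of _ "degree p"] degree_map_poly coeff_map_poly
        additive.sum[OF assms] additive_of_int_mult[OF assms])
qed

lemma complex_poly_linear_factor:
  fixes p :: "complex poly"
  assumes "degree p = Suc n"
  obtains \<mu> q where "p = [:-\<mu>, 1:] * q" "degree q = n" "q \<noteq> 0"
proof -
  obtain \<mu> where "poly p \<mu> = 0"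
    using fundamental_theorem_of_algebra[of p] assms constant_degree[of p] by auto
  then obtain q where q: "p = [:-\<mu>, 1:] * q" by (auto simp: poly_eq_0_iff_dvd)
  have "q \<noteq> 0" using assms q by auto
  moreover have "degree p = Suc (degree q)" unfolding q using \<open>q \<noteq> 0\<close> by (subst degree_mult_eq) auto
  ultimately show ?thesis using that q assms by auto
qed

lemma apply_poly_const:
  assumes "degree p = 0" "p \<noteq> 0" "\<And>x. apply_poly p b f x = 0"
  shows "f x = 0"
  using assms(3)[of x] assms(1,2) by (auto simp: apply_poly_def elim: degree_eq_zeroE)

text \<open>
  Split off a linear factor \<open>X - \<mu>\<close> of \<open>p\<close> and put \<open>h = T f - \<mu> f\<close>. If \<open>h\<close>
  vanishes, \<open>f\<close> itself is an eigenfunction of \<open>T\<close>; otherwise \<open>h\<close> is annihilated by a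
  polynomial of smaller degree. The last part of the conclusion holds because multiplications
  commute: whatever eigenvalues \<open>f\<close> already has are inherited by \<open>h\<close>. This is what allows
  further operators to be treated one after the other.
\<close>
lemma eigenfunction_exists:
  fixes f :: "'k::field_char_0 \<Rightarrow> complex"
  assumes "additive f" "\<exists>x. f x \<noteq> 0" "p \<noteq> 0" "\<And>x. apply_poly p b f x = 0"
  shows "\<exists>g \<mu>. additive g \<and> (\<exists>x. g x \<noteq> 0) \<and> (\<forall>x. g (b * x) = \<mu> * g x) \<and>
     (\<forall>a \<nu>. (\<forall>x. f (a * x) = \<nu> * f x) \<longrightarrow> (\<forall>x. g (a * x) = \<nu> * g x))"
  using assms
proof (induction "degree p" arbitrary: p f)
  case 0
  then show ?case using apply_poly_const by metis
next
  case (Suc n)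
  obtain \<mu> q where q: "p = [:-\<mu>, 1:] * q" "degree q = n" "q \<noteq> 0"
    using Suc.hyps(2) complex_poly_linear_factor by metis
  define h where "h = (\<lambda>y. f (b * y) - \<mu> * f y)"
  show ?case
  proof (cases "\<exists>x. h x \<noteq> 0")
    case False
    with Suc.prems show ?thesis by (intro exI[of _ f] exI[of _ \<mu>]) (auto simp: h_def)
  next
    case True
    have add: "additive h"
      by standard (simp add: h_def additive.add[OF Suc.prems(1)] algebra_simps)
    have "apply_poly q b h x = 0" for x
      using Suc.prems(4)[of x] unfolding q(1) apply_poly_linear_factor h_def .
    from Suc.hyps(1)[OF q(2)[symmetric] add True q(3) this]
    obtain g \<mu>' where g: "additive g" "\<exists>x. g x \<noteq> 0" "\<forall>x. g (b * x) = \<mu>' * g x"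
      "\<forall>a \<nu>. (\<forall>x. h (a * x) = \<nu> * h x) \<longrightarrow> (\<forall>x. g (a * x) = \<nu> * g x)" by blast
    have "\<forall>x. h (a * x) = \<nu> * h x" if "\<forall>x. f (a * x) = \<nu> * f x" for a \<nu>
    proof
      fix x
      have "f (b * (a * x)) = \<nu> * f (b * x)" using that[rule_format, of "b * x"]
        by (simp add: mult.left_commute)
      thus "h (a * x) = \<nu> * h x"
        unfolding h_def that[rule_format, of x] by (simp add: right_diff_distrib mult.left_commute[of \<nu> \<mu>])
    qed
    with g show ?thesis by blast
  qed
qed

lemma algebraic_int_polyE:
  assumes "algebraic x"
  obtains p :: "int poly" where "p \<noteq> 0" "poly (map_poly of_int p) x = 0"
proof -
  from assms obtain q where q: "\<forall>i. coeff q i \<in> \<int>" "q \<noteq> 0" "poly q x = 0"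
    by (auto simp: algebraic_def)
  from q(1) have "\<forall>i. \<exists>c. coeff q i = of_int c" by (blast elim: Ints_cases)
  then obtain c where c: "\<And>i. coeff q i = of_int (c i)" by metis
  define p where "p = (\<Sum>i\<le>degree q. monom (c i) i)"
  have "coeff p i = c i" for i
    using c[of i] by (cases "i \<le> degree q") (auto simp: p_def coeff_sum coeff_monom coeff_eq_0 sum.delta)
  hence "q = map_poly of_int p" by (intro poly_eqI) (simp add: coeff_map_poly c)
  with q that[of p] show ?thesis by auto
qed

lemma common_eigenfunction_exists:
  fixes f :: "'k::field_char_0 \<Rightarrow> complex"
  assumes "additive f" "\<exists>x. f x \<noteq> 0" "finite S" "\<And>b. b \<in> S \<Longrightarrow> algebraic b"
  shows "\<exists>g. additive g \<and> (\<exists>x. g x \<noteq> 0) \<and> (\<forall>b\<in>S. \<exists>\<mu>. \<forall>x. g (b * x) = \<mu> * g x) \<and>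
     (\<forall>a \<nu>. (\<forall>x. f (a * x) = \<nu> * f x) \<longrightarrow> (\<forall>x. g (a * x) = \<nu> * g x))"
  using assms(3,4)
proof (induction S)
  case empty
  with assms show ?case by blast
next
  case (insert b S)
  then obtain g where g: "additive g" "\<exists>x. g x \<noteq> 0" "\<forall>b\<in>S. \<exists>\<mu>. \<forall>x. g (b * x) = \<mu> * g x"
     "\<forall>a \<nu>. (\<forall>x. f (a * x) = \<nu> * f x) \<longrightarrow> (\<forall>x. g (a * x) = \<nu> * g x)" by auto
  obtain p where p: "p \<noteq> 0" "poly (map_poly of_int p) b = 0"
    using insert.prems algebraic_int_polyE by (metis insertI1)
  have "apply_poly (map_poly of_int p) b g x = 0" for x
    using p by (simp add: apply_poly_of_int[OF g(1)] additive.zero[OF g(1)])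
  moreover have "map_poly of_int p \<noteq> (0 :: complex poly)" using p by (simp add: map_poly_eq_0_iff)
  ultimately obtain h \<mu> where h: "additive h" "\<exists>x. h x \<noteq> 0" "\<forall>x. h (b * x) = \<mu> * h x"
     "\<forall>a \<nu>. (\<forall>x. g (a * x) = \<nu> * g x) \<longrightarrow> (\<forall>x. h (a * x) = \<nu> * h x)"
    using eigenfunction_exists[OF g(1,2)] by blast
  have "\<forall>b'\<in>S. \<exists>\<mu>. \<forall>x. h (b' * x) = \<mu> * h x" using g(3) h(4) by blast
  with h(3) have "\<forall>b'\<in>insert b S. \<exists>\<mu>. \<forall>x. h (b' * x) = \<mu> * h x" by blast
  moreover have "\<forall>a \<nu>. (\<forall>x. f (a * x) = \<nu> * f x) \<longrightarrow> (\<forall>x. h (a * x) = \<nu> * h x)"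
    using g(4) h(4) by blast
  ultimately show ?case using h(1,2) by (intro exI[of _ h] conjI)
qed

lemma algebraic_if_powers_coincide:
  assumes "x ^ m = x ^ n" "m \<noteq> n"
  shows "algebraic (x :: 'a::field_char_0)"
proof (rule algebraicI)
  have "coeff (monom 1 m - monom 1 n) m \<noteq> coeff (0 :: 'a poly) m"
    using assms(2) by simp
  thus "monom 1 m - monom 1 n \<noteq> (0 :: 'a poly)" by metis
qed (use assms(1) in \<open>simp_all add: poly_monom\<close>)

locale number_field_basis =
  finite_dimensional_vector_space "\<lambda>(q::rat) (x::'k). of_rat q * x" B
  for B :: "'k::field_char_0 set"
begin

text \<open>
  The powers of \<open>x\<close> cannot be infinitely many linearly independent elements.
\<close>
lemma algebraic_in_number_field: "algebraic (x::'k)"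
proof (cases "inj (\<lambda>n. x ^ n)")
  case False
  then show ?thesis using algebraic_if_powers_coincide by (auto simp: inj_on_def)
next
  case True
  hence "dependent (range (\<lambda>n. x ^ n))"
    using finiteI_independent[of "range (\<lambda>n. x ^ n)"] finite_imageD[of "\<lambda>n. x ^ n" UNIV] by blast
  then obtain T u where T: "finite T" "T \<subseteq> range (\<lambda>n. x ^ n)" "(\<Sum>v\<in>T. of_rat (u v) * v) = 0"
    "\<exists>v\<in>T. u v \<noteq> 0" unfolding dependent_explicit by blast
  then obtain N where N: "finite N" "T = (\<lambda>n. x ^ n) ` N" using finite_subset_image by metis
  define p where "p = (\<Sum>n\<in>N. monom (of_rat (u (x ^ n))) n :: 'k poly)"
  have c: "coeff p n = (if n \<in> N then of_rat (u (x ^ n)) else 0)" for n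
    using N(1) by (simp add: p_def coeff_sum coeff_monom if_distrib[of of_rat] sum.delta cong: if_cong)
  have "p \<noteq> 0" using T(4) N(2) c by (metis coeff_0 imageE of_rat_eq_0_iff)
  moreover have "poly p x = 0"
    using T(3) unfolding N(2) p_def
    by (subst (asm) sum.reindex) (auto simp: poly_sum poly_monom intro: inj_on_subset[OF True])
  moreover have "\<forall>i. coeff p i \<in> \<rat>" by (simp add: c)
  ultimately show ?thesis unfolding algebraic_altdef by blast
qed

end

section \<open>Embeddings and algebraic integers with small conjugates\<close>

lemma additive_of_rat_mult:
  fixes f :: "'a::field_char_0 \<Rightarrow> 'b::field_char_0"
  assumes "additive f"
  shows "f (of_rat q * x) = of_rat q * f x"
proof -
  obtain a b where ab: "quotient_of q = (a, b)" by force
  have b: "b > 0" using quotient_of_denom_pos[OF ab] .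
  have q: "q = of_int a / of_int b" by (rule quotient_of_div[OF ab])
  have "of_int b * f (of_rat q * x) = f (of_int b * (of_rat q * x))"
    by (rule additive_of_int_mult[OF assms, symmetric])
  also have "of_int b * (of_rat q * x) = of_int a * x"
    using b by (simp add: q of_rat_divide)
  also have "f (of_int a * x) = of_int a * f x" by (rule additive_of_int_mult[OF assms])
  finally show ?thesis using b by (simp add: q of_rat_divide field_simps)
qed

text \<open>
  Once \<open>u (Suc k) - \<mu> u k\<close> has become small, each step shrinks the norm of \<open>u\<close> by the
  factor \<open>norm \<mu> < 1\<close> up to a small error, and these errors sum to a geometric series.
\<close>
lemma tendsto_zero_if_contracting_recurrence:
  fixes u :: "nat \<Rightarrow> 'a::real_normed_div_algebra"
  assumes lim: "(\<lambda>k. u (Suc k) - \<mu> * u k) \<longlonglongrightarrow> 0" and "norm \<mu> < 1"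
  shows "u \<longlonglongrightarrow> 0"
proof (rule LIMSEQ_I)
  fix e :: real assume e: "e > 0"
  define r where "r = norm \<mu>"
  have r: "0 \<le> r" "r < 1" using assms by (auto simp: r_def)
  \<comment> \<open>An error below \<open>e / 2 * (1 - r)\<close> in each step adds up to at most \<open>e / 2\<close>.\<close>
  have "e / 2 * (1 - r) > 0" using e r by simp
  then obtain N where N: "\<And>k. k \<ge> N \<Longrightarrow> norm (u (Suc k) - \<mu> * u k) < e / 2 * (1 - r)"
    using LIMSEQ_D[OF lim] by (metis diff_zero)
  have bound: "norm (u (N + j)) \<le> r ^ j * norm (u N) + e / 2" for j
  proof (induction j)
    case 0
    then show ?case using e by simp
  next
    case (Suc j)
    have "norm (u (N + Suc j)) \<le> norm (u (Suc (N + j)) - \<mu> * u (N + j)) + norm (\<mu> * u (N + j))"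
      using norm_triangle_ineq[of "u (Suc (N + j)) - \<mu> * u (N + j)" "\<mu> * u (N + j)"] by simp
    also have "\<dots> \<le> e / 2 * (1 - r) + r * (r ^ j * norm (u N) + e / 2)"
      using N[of "N + j"] Suc r by (intro add_mono) (auto simp: norm_mult r_def intro!: mult_left_mono)
    also have "\<dots> = r ^ Suc j * norm (u N) + e / 2" by (simp add: field_simps)
    finally show ?case .
  qed
  have "(\<lambda>j. r ^ j * norm (u N)) \<longlonglongrightarrow> 0 * norm (u N)"
    using r by (intro tendsto_mult tendsto_const LIMSEQ_power_zero) auto
  then obtain J where J: "\<And>j. j \<ge> J \<Longrightarrow> r ^ j * norm (u N) < e / 2"
    using LIMSEQ_D[of "\<lambda>j. r ^ j * norm (u N)" 0 "e / 2"] e by fastforce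
  have "norm (u k - 0) < e" if "k \<ge> N + J" for k
  proof -
    have "J \<le> k - N" using that by linarith
    from bound[of "k - N"] J[OF this] that show ?thesis by simp
  qed
  thus "\<exists>no. \<forall>n\<ge>no. norm (u n - 0) < e" by blast
qed

lemma common_denominator:
  fixes r :: "nat \<Rightarrow> rat"
  shows "\<exists>D::int. D > 0 \<and> (\<forall>i<m. of_int D * r i \<in> \<int>)"
proof (induction m)
  case (Suc m)
  then obtain D where D: "D > 0" "\<And>i. i < m \<Longrightarrow> of_int D * r i \<in> \<int>" by blast
  obtain a b where ab: "quotient_of (r m) = (a, b)" by force
  have b: "b > 0" using quotient_of_denom_pos[OF ab] .
  have q: "of_int b * r m = of_int a" using quotient_of_div[OF ab] b by simp
  have "of_int (b * D) * r i \<in> \<int>" if "i < Suc m" for i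
  proof (cases "i = m")
    case True
    have "of_int (b * D) * r i = of_int D * (of_int b * r m)" using True by simp
    thus ?thesis by (simp only: q) auto
  next
    case False
    hence "of_int b * (of_int D * r i) \<in> \<int>" using D(2)[of i] that by auto
    thus ?thesis by (simp add: mult.assoc)
  qed
  with b D(1) show ?case by (intro exI[of _ "b * D"]) auto
qed (auto intro: exI[of _ 1])

text \<open>
  A monic equation of degree \<open>m\<close> makes every power of \<open>b\<close> an integer combination of the
  first \<open>m\<close> powers, so that a common denominator for those serves for all.
\<close>
lemma bounded_denominators_of_powers:
  fixes h :: "'a::field_char_0 \<Rightarrow> rat"
  assumes "additive h" "algebraic_int b"
  shows "\<exists>D::int. D > 0 \<and> (\<forall>k. of_int D * h (b ^ k) \<in> \<int>)"
proof -
  obtain m c where m: "m > 0" "b ^ m = (\<Sum>i<m. of_int (c i) * b ^ i)"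
    using assms(2) by (rule algebraic_int_power_reduction)
  obtain D :: int where D: "D > 0" "\<And>i. i < m \<Longrightarrow> of_int D * h (b ^ i) \<in> \<int>"
    using common_denominator[of m "\<lambda>i. h (b ^ i)"] by blast
  have "of_int D * h (b ^ k) \<in> \<int>" for k
  proof (induction k rule: less_induct)
    case (less k)
    show ?case
    proof (cases "k < m")
      case False
      hence "b ^ k = b ^ (k - m) * b ^ m" by (simp flip: power_add)
      also have "\<dots> = (\<Sum>i<m. of_int (c i) * b ^ (k - m + i))"
        by (simp add: m(2) sum_distrib_left power_add mult.left_commute)
      finally have eq: "of_int D * h (b ^ k) = (\<Sum>i<m. of_int (c i) * (of_int D * h (b ^ (k - m + i))))"
        by (simp add: additive.sum[OF assms(1)] additive_of_int_mult[OF assms(1)] sum_distrib_left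
            mult.left_commute)
      have "of_int (c i) * (of_int D * h (b ^ (k - m + i))) \<in> \<int>" if "i < m" for i
        using that False by (intro Ints_mult[OF Ints_of_int] less) auto
      thus ?thesis unfolding eq by (intro Ints_sum) simp
    qed (use D in auto)
  qed
  with D(1) show ?thesis by blast
qed

lemma field_embedding_0: "field_embedding \<sigma> \<Longrightarrow> \<sigma> 0 = 0"
  unfolding field_embedding_def by (metis add_cancel_right_right)

lemma field_embedding_additive: "field_embedding \<sigma> \<Longrightarrow> additive \<sigma>"
  unfolding field_embedding_def by unfold_locales blast

context number_field_basis
begin

text \<open>
  A common eigenfunction \<open>g\<close> of the multiplications by the basis elements is an
  eigenfunction of all multiplications, and \<open>g (a x) = \<sigma>(a) g x\<close> forces \<open>\<sigma>\<close> to be a ring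
  homomorphism. Since \<open>g\<close> inherits the eigenvalues of \<open>f\<close>, so does \<open>\<sigma>\<close>; this shows
  that each eigenvalue of multiplication by \<open>a\<close> is a conjugate of \<open>a\<close>.
\<close>
lemma embedding_from_additive:
  fixes f :: "'k \<Rightarrow> complex"
  assumes "additive f" "\<exists>x. f x \<noteq> 0"
  obtains \<sigma> :: "'k \<Rightarrow> complex" where "field_embedding \<sigma>"
    "\<And>a \<nu>. (\<And>x. f (a * x) = \<nu> * f x) \<Longrightarrow> \<sigma> a = \<nu>"
proof -
  obtain g where g: "additive g" "\<exists>x. g x \<noteq> 0" "\<forall>b\<in>B. \<exists>\<mu>. \<forall>x. g (b * x) = \<mu> * g x"
     "\<forall>a \<nu>. (\<forall>x. f (a * x) = \<nu> * f x) \<longrightarrow> (\<forall>x. g (a * x) = \<nu> * g x)"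
    using common_eigenfunction_exists[OF assms finite_Basis algebraic_in_number_field] by metis
  have eigen: "\<exists>\<mu>. \<forall>x. g (a * x) = \<mu> * g x" for a
  proof -
    have "a \<in> span B" by (simp add: span_Basis)
    thus ?thesis
    proof (induction rule: span_induct_alt)
      case base
      show ?case by (intro exI[of _ 0]) (simp add: additive.zero[OF g(1)])
    next
      case (step q b y)
      then obtain \<mu> \<mu>' where \<mu>: "\<forall>x. g (b * x) = \<mu> * g x" "\<forall>x. g (y * x) = \<mu>' * g x"
        using g(3) by blast
      have "g ((of_rat q * b + y) * x) = (of_rat q * \<mu> + \<mu>') * g x" for x
        using \<mu> by (simp add: distrib_right additive.add[OF g(1)] mult.assoc additive_of_rat_mult[OF g(1)])
      thus ?case by blast
    qed
  qed
  have g1: "g 1 \<noteq> 0"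
  proof
    assume "g 1 = 0"
    hence "g a = 0" for a using eigen[of a] by (metis mult.right_neutral mult_zero_right)
    with g(2) show False by blast
  qed
  define \<sigma> where "\<sigma> a = g a / g 1" for a
  have \<sigma>: "\<sigma> a = \<nu>" if "\<forall>x. g (a * x) = \<nu> * g x" for a \<nu>
    using that[rule_format, of 1] g1 by (simp add: \<sigma>_def)
  hence mult: "g (a * x) = \<sigma> a * g x" for a x using eigen[of a] by metis
  have "field_embedding \<sigma>"
    unfolding field_embedding_def
    using g1 mult by (auto simp: \<sigma>_def additive.add[OF g(1)] add_divide_distrib)
  moreover have "\<sigma> a = \<nu>" if "\<And>x. f (a * x) = \<nu> * f x" for a \<nu>
    using \<sigma> g(4) that by blast
  ultimately show ?thesis using that by blast
qed

lemma additive_coordinate: "additive (\<lambda>x. representation B x e)"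
  by standard (simp add: representation_add[OF independent_Basis] span_Basis)

lemma additive_coordinate_of_rat:
  "additive (\<lambda>x. of_rat (representation B x e) :: 'b::field_char_0)"
  by standard (simp add: additive.add[OF additive_coordinate] of_rat_add)

lemma coordinates_eq_0_iff: "(\<forall>e\<in>B. representation B x e = 0) \<longleftrightarrow> x = 0"
proof
  assume *: "\<forall>e\<in>B. representation B x e = 0"
  have "x = (\<Sum>e\<in>B. of_rat (representation B x e) * e)"
    by (rule sum_representation_eq[symmetric]) (auto simp: independent_Basis span_Basis finite_Basis)
  also have "\<dots> = 0" using * by simp
  finally show "x = 0" .
qed (simp add: representation_zero)

lemma embedding_exists: "\<exists>\<sigma> :: 'k \<Rightarrow> complex. field_embedding \<sigma>"
proof -
  obtain e where "representation B 1 e \<noteq> 0" using coordinates_eq_0_iff[of 1] by auto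
  hence "\<exists>x. (of_rat (representation B x e) :: complex) \<noteq> 0" by auto
  from embedding_from_additive[OF additive_coordinate_of_rat this] show ?thesis by metis
qed

text \<open>
  Induction over the linear factors \<open>X - \<mu>\<close> of \<open>p\<close>. If \<open>norm \<mu> < 1\<close>, the induction
  hypothesis applies to \<open>T f - \<mu> f\<close>, and \<open>f (b\<^sup>k x)\<close> satisfies a contracting recurrence. If
  not, \<open>\<mu>\<close> is not a conjugate of \<open>b\<close>, hence not an eigenvalue of \<open>T\<close>, and the factor can be
  cancelled.
\<close>
lemma additive_powers_tendsto_zero:
  fixes f :: "'k \<Rightarrow> complex"
  assumes "\<And>\<sigma> :: 'k \<Rightarrow> complex. field_embedding \<sigma> \<Longrightarrow> norm (\<sigma> b) < 1"
    and "additive f" "p \<noteq> 0" "\<And>x. apply_poly p b f x = 0"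
  shows "(\<lambda>k. f (b ^ k * x)) \<longlonglongrightarrow> 0"
  using assms(2-)
proof (induction "degree p" arbitrary: p f)
  case 0
  hence "f x = 0" for x using apply_poly_const by metis
  then show ?case by simp
next
  case (Suc n)
  obtain \<mu> q where q: "p = [:-\<mu>, 1:] * q" "degree q = n" "q \<noteq> 0"
    using Suc.hyps(2) complex_poly_linear_factor by metis
  show ?case
  proof (cases "norm \<mu> < 1")
    case True
    define h where "h = (\<lambda>y. f (b * y) - \<mu> * f y)"
    have "additive h"
      by standard (simp add: h_def additive.add[OF Suc.prems(1)] algebra_simps)
    moreover have "apply_poly q b h x = 0" for x
      using Suc.prems(3)[of x] unfolding q(1) apply_poly_linear_factor h_def .
    ultimately have "(\<lambda>k. h (b ^ k * x)) \<longlonglongrightarrow> 0"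
      using q by (intro Suc.hyps(1)) auto
    hence "(\<lambda>k. f (b ^ Suc k * x) - \<mu> * f (b ^ k * x)) \<longlonglongrightarrow> 0"
      by (simp add: h_def mult.assoc)
    thus ?thesis using True by (rule tendsto_zero_if_contracting_recurrence)
  next
    case False
    \<comment> \<open>Otherwise \<open>apply_poly q b f\<close> would be an eigenfunction with eigenvalue \<open>\<mu>\<close>.\<close>
    have "apply_poly q b f y = 0" for y
    proof (rule ccontr)
      assume nz: "apply_poly q b f y \<noteq> 0"
      obtain \<sigma> :: "'k \<Rightarrow> complex" where \<sigma>: "field_embedding \<sigma>"
        "\<And>a \<nu>. (\<And>x. apply_poly q b f (a * x) = \<nu> * apply_poly q b f x) \<Longrightarrow> \<sigma> a = \<nu>"
        using embedding_from_additive[OF additive_apply_poly[OF Suc.prems(1), of q b]] nz by metis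
      have "apply_poly q b f (b * x) = \<mu> * apply_poly q b f x" for x
        using Suc.prems(3)[of x] unfolding q(1) apply_poly_linear_factor apply_poly_shift by simp
      from \<sigma>(2)[OF this] assms(1)[OF \<sigma>(1)] False show False by simp
    qed
    thus ?thesis using Suc.prems q by (intro Suc.hyps(1)) auto
  qed
qed

lemma algebraic_int_eq_0_if_conjugates_small:
  fixes b :: 'k
  assumes "algebraic_int b"
    and small: "\<And>\<sigma> :: 'k \<Rightarrow> complex. field_embedding \<sigma> \<Longrightarrow> norm (\<sigma> b) < 1"
  shows "b = 0"
proof -
  obtain p :: "int poly" where p: "p \<noteq> 0" "poly (map_poly of_int p) b = 0"
    using algebraic_in_number_field by (rule algebraic_int_polyE)
  have p': "map_poly of_int p \<noteq> (0 :: complex poly)" using p by simp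
  have "eventually (\<lambda>k. representation B (b ^ k) e = 0) sequentially" for e
  proof -
    define h where "h = (\<lambda>x. representation B x e)"
    define f where "f = (\<lambda>x. of_rat (h x) :: complex)"
    have h: "additive h" unfolding h_def by (rule additive_coordinate)
    have f: "additive f" unfolding f_def h_def by (rule additive_coordinate_of_rat)
    obtain D :: int where D: "D > 0" "\<And>k. of_int D * h (b ^ k) \<in> \<int>"
      using bounded_denominators_of_powers[OF h assms(1)] by blast
    have "apply_poly (map_poly of_int p) b f x = 0" for x
      using p by (simp add: apply_poly_of_int[OF f] additive.zero[OF f])
    hence "(\<lambda>k. f (b ^ k * 1)) \<longlonglongrightarrow> 0"
      using small f p' by (intro additive_powers_tendsto_zero) auto
    hence "(\<lambda>k. of_int D * f (b ^ k)) \<longlonglongrightarrow> of_int D * 0"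
      by (intro tendsto_mult tendsto_const) simp_all
    hence "eventually (\<lambda>k. dist (of_int D * f (b ^ k)) 0 < 1) sequentially"
      by (intro tendstoD) simp_all
    thus ?thesis
    proof eventually_elim
      case (elim k)
      obtain i where i: "of_int D * h (b ^ k) = of_int i" using D(2)[of k] by (auto elim: Ints_cases)
      have "of_int D * f (b ^ k) = of_rat (of_int D * h (b ^ k))"
        by (simp add: f_def of_rat_mult)
      also have "\<dots> = of_int i" by (simp add: i)
      finally have "norm (of_int i :: complex) < 1" using elim by simp
      hence "i = 0" by (simp add: norm_of_int)
      with i D(1) show ?case by (simp add: h_def)
    qed
  qed
  hence "eventually (\<lambda>k. \<forall>e\<in>B. representation B (b ^ k) e = 0) sequentially"
    by (intro eventually_ball_finite finite_Basis) auto
  hence "eventually (\<lambda>k. b ^ k = 0) sequentially" by (simp only: coordinates_eq_0_iff)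
  then obtain k where "b ^ k = 0" by (auto simp: eventually_sequentially)
  thus ?thesis by simp
qed

end

section \<open>Totally positive integers below a given number\<close>

lemma field_embedding_power: "field_embedding \<sigma> \<Longrightarrow> \<sigma> (x ^ n) = \<sigma> x ^ n"
  unfolding field_embedding_def by (induction n) auto

lemma field_embedding_eq_0_iff:
  assumes "field_embedding \<sigma>"
  shows "\<sigma> x = 0 \<longleftrightarrow> x = 0"
proof
  assume "\<sigma> x = 0"
  moreover have "\<sigma> (x * inverse x) = \<sigma> x * \<sigma> (inverse x)" "\<sigma> 1 = 1"
    using assms by (auto simp: field_embedding_def)
  ultimately show "x = 0" by (cases "x = 0") auto
qed (simp add: field_embedding_0[OF assms])

lemma field_embedding_poly:
  fixes \<sigma> :: "'a::field_char_0 \<Rightarrow> 'b::field_char_0"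
  assumes "field_embedding \<sigma>"
  shows "\<sigma> (poly (map_poly of_int p) x) = poly (map_poly of_int p) (\<sigma> x)"
  using field_embedding_additive[OF assms]
  by (simp add: poly_altdef additive.sum additive_of_int_mult field_embedding_power[OF assms])

lemma embedding_into_reals:
  assumes "field_embedding \<sigma>" "range \<sigma> \<subseteq> \<real>"
  obtains \<tau> :: "'k::field \<Rightarrow> real" where "field_embedding \<tau>" "\<And>x. \<sigma> x = complex_of_real (\<tau> x)"
proof -
  define \<tau> where "\<tau> x = Re (\<sigma> x)" for x
  have \<tau>: "\<sigma> x = complex_of_real (\<tau> x)" for x
    using assms(2) by (simp add: \<tau>_def image_subset_iff)
  have "field_embedding \<tau>"
    using assms(1) unfolding field_embedding_def \<tau> by (metis of_real_1 of_real_add of_real_mult of_real_eq_iff)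
  with \<tau> that show ?thesis by blast
qed

definition tp_interval :: "'k::field_char_0 \<Rightarrow> 'k set" where
  "tp_interval \<gamma> = {\<alpha> \<in> tp_integers0. \<gamma> - \<alpha> \<in> tp_integers0}"

lemma tp_integers_add:
  assumes "x \<in> tp_integers" "y \<in> tp_integers"
  shows "x + y \<in> tp_integers"
  using assms algebraic_int_add[of x y]
  by (auto simp: tp_integers_def ring_of_integers_def totally_positive_def field_embedding_def add_pos_pos)

lemma zero_in_tp_integers0 [simp]: "0 \<in> tp_integers0"
  by (simp add: tp_integers0_def)

lemma tp_integers0_add: "x \<in> tp_integers0 \<Longrightarrow> y \<in> tp_integers0 \<Longrightarrow> x + y \<in> tp_integers0"
  using tp_integers_add by (auto simp: tp_integers0_def)

lemma tp_integers0_sum: "(\<And>i. i \<in> A \<Longrightarrow> f i \<in> tp_integers0) \<Longrightarrow> sum f A \<in> tp_integers0"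
  by (induction A rule: infinite_finite_induct) (auto intro: tp_integers0_add)

lemma tp_integers0_of_nat_mult: "x \<in> tp_integers0 \<Longrightarrow> of_nat n * x \<in> tp_integers0"
  by (induction n) (auto simp: distrib_right intro: tp_integers0_add)

locale totally_real_field = number_field_basis B
  for B :: "'k::field_char_0 set" +
  assumes totally_real: "totally_real TYPE('k)"
begin

lemma real_embedding_exists: "\<exists>\<tau> :: 'k \<Rightarrow> real. field_embedding \<tau>"
  using embedding_exists embedding_into_reals totally_real unfolding totally_real_def by metis

text \<open>
  An embedding is determined by its values on a basis, and its value at \<open>b\<close> is a root of a
  polynomial that annihilates \<open>b\<close>.
\<close>
lemma finite_real_embeddings: "finite {\<tau> :: 'k \<Rightarrow> real. field_embedding \<tau>}" (is "finite ?E")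
proof -
  have "\<forall>b::'k. \<exists>p :: int poly. p \<noteq> 0 \<and> poly (map_poly of_int p) b = 0"
    using algebraic_in_number_field algebraic_int_polyE by metis
  then obtain p :: "'k \<Rightarrow> int poly" where p: "\<And>b. p b \<noteq> 0" "\<And>b. poly (map_poly of_int (p b)) b = 0"
    by metis
  define R where "R b = {t :: real. poly (map_poly of_int (p b)) t = 0}" for b
  have R: "finite (R b)" for b
    unfolding R_def by (rule poly_roots_finite) (simp add: p)
  have "(\<lambda>\<tau>. restrict \<tau> B) ` ?E \<subseteq> (\<Pi>\<^sub>E b\<in>B. R b)"
  proof (intro image_subsetI)
    fix \<tau> :: "'k \<Rightarrow> real" assume "\<tau> \<in> ?E"
    hence \<tau>: "field_embedding \<tau>" by simp
    show "restrict \<tau> B \<in> (\<Pi>\<^sub>E b\<in>B. R b)"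
      using field_embedding_poly[OF \<tau>, symmetric] by (auto simp: R_def p field_embedding_0[OF \<tau>])
  qed
  hence "finite ((\<lambda>\<tau>. restrict \<tau> B) ` ?E)"
    by (rule finite_subset) (intro finite_PiE finite_Basis R)
  moreover have "inj_on (\<lambda>\<tau>. restrict \<tau> B) ?E"
  proof (rule inj_onI, rule ext)
    fix \<sigma> \<tau> :: "'k \<Rightarrow> real" and x
    assume \<sigma>: "\<sigma> \<in> ?E" and \<tau>: "\<tau> \<in> ?E" and eq: "restrict \<sigma> B = restrict \<tau> B"
    have add: "additive \<sigma>" "additive \<tau>" using \<sigma> \<tau> by (simp_all add: field_embedding_additive)
    have "x \<in> span B" by (simp add: span_Basis)
    thus "\<sigma> x = \<tau> x"
    proof (induction rule: span_induct_alt)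
      case base
      show ?case by (simp add: add additive.zero)
    next
      case (step q b y)
      have "\<sigma> b = \<tau> b" using fun_cong[OF eq, of b] step by simp
      with step show ?case by (simp add: add additive.add additive_of_rat_mult)
    qed
  qed
  ultimately show ?thesis by (rule finite_imageD)
qed

text \<open>
  The integer parts of all conjugates take finitely many values on the interval, and they
  separate its elements by \<open>algebraic_int_eq_0_if_conjugates_small\<close>.
\<close>
lemma finite_tp_interval: "finite (tp_interval (\<gamma> :: 'k))"
proof -
  define E where "E = {\<tau> :: 'k \<Rightarrow> real. field_embedding \<tau>}"
  define F where "F \<alpha> = (\<lambda>\<tau>\<in>E. \<lfloor>\<tau> \<alpha>\<rfloor>)" for \<alpha>
  have nonneg: "\<tau> \<alpha> \<ge> 0" if "\<alpha> \<in> tp_integers0" "field_embedding \<tau>" for \<alpha> :: 'k and \<tau> :: "'k \<Rightarrow> real"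
    using that by (auto simp: tp_integers0_def tp_integers_def totally_positive_def field_embedding_0
        intro: less_imp_le)
  have "F ` tp_interval \<gamma> \<subseteq> (\<Pi>\<^sub>E \<tau>\<in>E. {0..\<lfloor>\<tau> \<gamma>\<rfloor>})"
  proof (intro image_subsetI)
    fix \<alpha> assume \<alpha>: "\<alpha> \<in> tp_interval \<gamma>"
    have "0 \<le> \<tau> \<alpha> \<and> \<tau> \<alpha> \<le> \<tau> \<gamma>" if "field_embedding \<tau>" for \<tau> :: "'k \<Rightarrow> real"
      using \<alpha> nonneg[of \<alpha> \<tau>] nonneg[of "\<gamma> - \<alpha>" \<tau>] that additive.diff[OF field_embedding_additive[OF that]]
      by (simp add: tp_interval_def)
    thus "F \<alpha> \<in> (\<Pi>\<^sub>E \<tau>\<in>E. {0..\<lfloor>\<tau> \<gamma>\<rfloor>})"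
      by (auto simp: F_def E_def intro!: floor_mono)
  qed
  hence "finite (F ` tp_interval \<gamma>)"
    by (rule finite_subset) (use finite_real_embeddings in \<open>auto simp: E_def intro!: finite_PiE\<close>)
  moreover have "inj_on F (tp_interval \<gamma>)"
  proof (rule inj_onI)
    fix \<alpha> \<beta> assume \<alpha>\<beta>: "\<alpha> \<in> tp_interval \<gamma>" "\<beta> \<in> tp_interval \<gamma>" and eq: "F \<alpha> = F \<beta>"
    have int: "algebraic_int x" if "x \<in> tp_interval \<gamma>" for x
      using that by (auto simp: tp_interval_def tp_integers0_def tp_integers_def ring_of_integers_def)
    have "algebraic_int (\<alpha> - \<beta>)"
      using algebraic_int_add[of \<alpha> "- \<beta>"] int \<alpha>\<beta> by (simp add: algebraic_int_minus)
    moreover have "norm (\<sigma> (\<alpha> - \<beta>)) < 1" if \<sigma>: "field_embedding \<sigma>" for \<sigma> :: "'k \<Rightarrow> complex"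
    proof -
      obtain \<tau> :: "'k \<Rightarrow> real" where \<tau>: "field_embedding \<tau>" "\<And>x. \<sigma> x = complex_of_real (\<tau> x)"
        using embedding_into_reals[OF \<sigma>] totally_real \<sigma> unfolding totally_real_def by metis
      have "\<lfloor>\<tau> \<alpha>\<rfloor> = \<lfloor>\<tau> \<beta>\<rfloor>" using fun_cong[OF eq, of \<tau>] \<tau>(1) by (simp add: F_def E_def)
      hence "\<bar>\<tau> \<alpha> - \<tau> \<beta>\<bar> < 1" by linarith
      thus ?thesis
        by (simp add: \<tau>(2) additive.diff[OF field_embedding_additive[OF \<tau>(1)]] del: of_real_diff)
    qed
    ultimately have "\<alpha> - \<beta> = 0" by (rule algebraic_int_eq_0_if_conjugates_small)
    thus "\<alpha> = \<beta>" by simp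
  qed
  ultimately show ?thesis by (rule finite_imageD)
qed

lemma zero_notin_tp_integers: "(0 :: 'k) \<notin> tp_integers"
  using real_embedding_exists field_embedding_0
  by (fastforce simp: tp_integers_def totally_positive_def)

lemma tp_integers0_antisym:
  assumes "x \<in> tp_integers0" "- x \<in> tp_integers0"
  shows "x = (0 :: 'k)"
  using assms zero_notin_tp_integers tp_integers_add[of x "- x"] by (auto simp: tp_integers0_def)

text \<open>
  The partial sums of \<open>P\<close>, from the empty one to the full one and in any order of the parts,
  are distinct elements of the interval. The
  remainder \<open>\<beta>\<close> makes the bound apply to multisets that only add up to a part of a given
  number.
\<close>
lemma size_less_card_tp_interval:
  assumes "set_mset P \<subseteq> tp_integers" "\<beta> \<in> tp_integers0"
  shows "size P < card (tp_interval (sum_mset P + \<beta> :: 'k))"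
  using assms(1)
proof (induction P)
  case empty
  have "\<beta> \<in> tp_interval \<beta>" using assms(2) by (simp add: tp_interval_def)
  thus ?case using finite_tp_interval by (auto simp: card_gt_0_iff)
next
  case (add a P)
  define \<gamma> where "\<gamma> = sum_mset P + \<beta>"
  have a: "a \<in> tp_integers0" "a \<noteq> 0"
    using add.prems zero_notin_tp_integers by (auto simp: tp_integers0_def)
  have "sum_mset P \<in> tp_integers0"
    using add.prems by (induction P) (auto simp: tp_integers0_def intro: tp_integers_add)
  hence \<gamma>: "\<gamma> \<in> tp_integers0" using assms(2) by (simp add: \<gamma>_def tp_integers0_add)
  have "tp_interval \<gamma> \<subseteq> tp_interval (a + \<gamma>)"
    using tp_integers0_add[OF a(1)] by (force simp: tp_interval_def add_diff_eq)
  moreover have "a + \<gamma> \<in> tp_interval (a + \<gamma>)" using a \<gamma> by (simp add: tp_interval_def tp_integers0_add)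
  moreover have "a + \<gamma> \<notin> tp_interval \<gamma>"
    using tp_integers0_antisym[OF a(1)] a(2) by (auto simp: tp_interval_def)
  ultimately have "card (tp_interval \<gamma>) < card (tp_interval (a + \<gamma>))"
    by (intro psubset_card_mono finite_tp_interval) blast
  with add show ?case by (simp add: \<gamma>_def add.assoc)
qed

end

section \<open>Chain partitions and linear equations\<close>

definition weighted_solutions :: "nat set \<Rightarrow> 'k::field_char_0 \<Rightarrow> (nat \<Rightarrow> 'k) set" where
  "weighted_solutions J \<delta> = {x \<in> J \<rightarrow>\<^sub>E tp_integers0. \<delta> = (\<Sum>i\<in>J. of_nat i * x i)}"

text \<open>
  Chains of a fixed length: allowing zero entries turns the bound \<open>m\<close> on the number of parts
  into an equality.
\<close>
definition chain_lists :: "nat \<Rightarrow> 'k::field_char_0 \<Rightarrow> 'k list set" where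
  "chain_lists m \<delta> = {ys. length ys = m \<and> set ys \<subseteq> tp_integers0 \<and>
     sorted_wrt (\<lambda>x y. y - x \<in> tp_integers0) ys \<and> sum_list ys = \<delta>}"

lemma transp_tp_integers0: "transp (\<lambda>x y. y - x \<in> tp_integers0)"
  by (rule transpI) (metis diff_add_cancel add_diff_eq tp_integers0_add)

text \<open>
  Exactly \<open>i\<close> of the tails contain the term \<open>x i\<close>.
\<close>
lemma sum_of_tails:
  "(\<Sum>j<m. \<Sum>i\<in>{m - j..m}. x i) = (\<Sum>i=1..m. of_nat i * (x i :: 'a::comm_ring_1))"
proof -
  have "(\<Sum>j<m. \<Sum>i\<in>{m - j..m}. x i) = (\<Sum>j<m. \<Sum>i | i \<in> {1..m} \<and> m - j \<le> i. x i)"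
    by (intro sum.cong) auto
  also have "\<dots> = (\<Sum>i=1..m. \<Sum>j | j \<in> {..<m} \<and> m - j \<le> i. x i)"
    by (rule sum.swap_restrict) auto
  also have "\<dots> = (\<Sum>i=1..m. of_nat i * x i)"
  proof (rule sum.cong)
    fix i assume i: "i \<in> {1..m}"
    hence "{j. j \<in> {..<m} \<and> m - j \<le> i} = {m - i..<m}" by auto
    with i show "(\<Sum>j | j \<in> {..<m} \<and> m - j \<le> i. x i) = of_nat i * x i" by simp
  qed simp
  finally show ?thesis .
qed

text \<open>
  The list starts with \<open>x m\<close> and ends with the sum of all \<open>x i\<close>, so that it increases
  when all \<open>x i\<close> are totally positive or zero. The inverse operation has to treat \<open>i = m\<close>
  apart, where the first entry of the list has no predecessor.
\<close>
definition tails :: "nat \<Rightarrow> (nat \<Rightarrow> 'a::comm_ring_1) \<Rightarrow> 'a list" where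
  "tails m x = map (\<lambda>j. \<Sum>i\<in>{m - j..m}. x i) [0..<m]"

definition differences :: "nat \<Rightarrow> 'a::comm_ring_1 list \<Rightarrow> nat \<Rightarrow> 'a" where
  "differences m ys = (\<lambda>i\<in>{1..m}. ys ! (m - i) - (if i = m then 0 else ys ! (m - i - 1)))"

lemma sum_list_tails: "sum_list (tails m x) = (\<Sum>i=1..m. of_nat i * x i)"
  unfolding sum_of_tails[symmetric] tails_def
  by (simp add: interv_sum_list_conv_sum_set_nat atLeast0LessThan)

lemma tails_differences:
  assumes "length ys = m"
  shows "tails m (differences m ys) = ys"
proof -
  have "(\<Sum>i\<in>{m - j..m}. differences m ys i) = ys ! j" if "j < m" for j
    using that
  proof (induction j)
    case 0
    then show ?case by (simp add: differences_def)
  next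
    case (Suc j)
    have "{m - Suc j..m} = insert (m - Suc j) {m - j..m}" using Suc.prems by auto
    hence "(\<Sum>i\<in>{m - Suc j..m}. differences m ys i) = differences m ys (m - Suc j) + ys ! j"
      using Suc by simp
    also have "differences m ys (m - Suc j) = ys ! Suc j - ys ! j"
      using Suc.prems by (auto simp: differences_def)
    finally show ?case by simp
  qed
  with assms show ?thesis by (intro nth_equalityI) (auto simp: tails_def)
qed

lemma differences_tails:
  assumes "x \<in> extensional {1..m}"
  shows "differences m (tails m x) = x"
proof
  fix i
  show "differences m (tails m x) i = x i"
  proof (cases "i \<in> {1..m}")
    case True
    have nth: "tails m x ! (m - k) = sum x {k..m}" if "1 \<le> k" "k \<le> m" for k
      using that by (simp add: tails_def)
    show ?thesis
    proof (cases "i = m")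
      case True
      with \<open>i \<in> {1..m}\<close> nth[of m] show ?thesis by (simp add: differences_def)
    next
      case False
      with True have i: "1 \<le> i" "Suc i \<le> m" by auto
      have "m - i - 1 = m - Suc i" by simp
      hence "differences m (tails m x) i = sum x {i..m} - sum x {Suc i..m}"
        using i False nth[of i] nth[of "Suc i"] by (simp add: differences_def del: diff_Suc_eq_diff_pred)
      also have "{i..m} = insert i {Suc i..m}" using i by auto
      finally show ?thesis by simp
    qed
  next
    case False
    with extensional_arb[OF assms this] show ?thesis by (auto simp: differences_def)
  qed
qed

text \<open>
  The conjugation of Young diagrams: the rows of the chain are the tail sums of the
  increments.
\<close>
lemma bij_betw_tails:
  "bij_betw (tails m) (weighted_solutions {1..m} \<delta>) (chain_lists m \<delta>)"
proof (rule bij_betw_byWitness[where f' = "differences m"])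
  show "\<forall>x\<in>weighted_solutions {1..m} \<delta>. differences m (tails m x) = x"
    by (auto simp: weighted_solutions_def PiE_def intro!: differences_tails)
  show "\<forall>ys\<in>chain_lists m \<delta>. tails m (differences m ys) = ys"
    by (auto simp: chain_lists_def intro!: tails_differences)
  show "tails m ` weighted_solutions {1..m} \<delta> \<subseteq> chain_lists m \<delta>"
  proof (intro image_subsetI)
    fix x assume x: "x \<in> weighted_solutions {1..m} \<delta>"
    hence tp: "\<And>i. i \<in> {1..m} \<Longrightarrow> x i \<in> tp_integers0" by (auto simp: weighted_solutions_def)
    have "(\<Sum>k\<in>{m - j..m}. x k) - (\<Sum>k\<in>{m - i..m}. x k) \<in> tp_integers0" if "i < j" "j < m" for i j
    proof -
      have "{m - j..m} = {m - j..<m - i} \<union> {m - i..m}" using that by auto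
      hence "(\<Sum>k\<in>{m - j..m}. x k) = (\<Sum>k\<in>{m - j..<m - i}. x k) + (\<Sum>k\<in>{m - i..m}. x k)"
        by (simp only:, subst sum.union_disjoint) auto
      moreover have "(\<Sum>k\<in>{m - j..<m - i}. x k) \<in> tp_integers0"
        using that by (intro tp_integers0_sum tp) auto
      ultimately show ?thesis by simp
    qed
    hence "sorted_wrt (\<lambda>x y. y - x \<in> tp_integers0) (tails m x)"
      by (auto simp: tails_def sorted_wrt_iff_nth_less)
    moreover have "set (tails m x) \<subseteq> tp_integers0"
      by (auto simp: tails_def intro!: tp_integers0_sum tp)
    moreover have "length (tails m x) = m" by (simp add: tails_def)
    ultimately show "tails m x \<in> chain_lists m \<delta>"
      using x sum_list_tails[of m x] by (simp add: chain_lists_def weighted_solutions_def)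
  qed
  show "differences m ` chain_lists m \<delta> \<subseteq> weighted_solutions {1..m} \<delta>"
  proof (intro image_subsetI)
    fix ys assume ys: "ys \<in> chain_lists m \<delta>"
    hence len: "length ys = m" by (simp add: chain_lists_def)
    have nth: "ys ! k \<in> tp_integers0" if "k < m" for k
      using ys that nth_mem[of k ys] by (auto simp: chain_lists_def)
    have diff: "ys ! l - ys ! k \<in> tp_integers0" if "k < l" "l < m" for k l
      using ys that by (simp add: chain_lists_def sorted_wrt_iff_nth_less)
    have "ys ! (m - i) - (if i = m then 0 else ys ! (m - i - 1)) \<in> tp_integers0" if "i \<in> {1..m}" for i
      using that nth[of 0] diff[of "m - i - 1" "m - i"] by auto
    hence "differences m ys \<in> {1..m} \<rightarrow>\<^sub>E tp_integers0"
      unfolding differences_def restrict_PiE_iff by blast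
    moreover have "(\<Sum>i=1..m. of_nat i * differences m ys i) = \<delta>"
      using ys unfolding sum_list_tails[symmetric] tails_differences[OF len]
      by (simp add: chain_lists_def)
    ultimately show "differences m ys \<in> weighted_solutions {1..m} \<delta>"
      by (simp add: weighted_solutions_def)
  qed
qed

context totally_real_field
begin

text \<open>
  A real embedding is injective and order preserving, so that a chain is sorted by a linear
  order, and a sorted list is determined by its multiset.
\<close>
lemma chain_list_unique:
  assumes "mset xs = mset (ys :: 'k list)"
    and "sorted_wrt (\<lambda>x y. y - x \<in> tp_integers0) xs" "sorted_wrt (\<lambda>x y. y - x \<in> tp_integers0) ys"
  shows "xs = ys"
proof -
  obtain \<tau> :: "'k \<Rightarrow> real" where \<tau>: "field_embedding \<tau>" using real_embedding_exists by blast
  note diff = additive.diff[OF field_embedding_additive[OF \<tau>]]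
  have mono: "\<tau> x \<le> \<tau> y" if "y - x \<in> tp_integers0" for x y
    using that \<tau> diff[of y x] field_embedding_0[OF \<tau>]
    by (fastforce simp: tp_integers0_def tp_integers_def totally_positive_def)
  have inj: "inj \<tau>"
    using field_embedding_eq_0_iff[OF \<tau>] diff by (metis eq_iff_diff_eq_0 injI)
  have "sorted (map \<tau> zs)" if "sorted_wrt (\<lambda>x y. y - x \<in> tp_integers0) zs" for zs
    using that by (auto simp: sorted_wrt_map intro: sorted_wrt_mono_rel[rotated] mono)
  hence "map \<tau> xs = map \<tau> ys"
    using assms by (metis mset_map sorted_sort_id properties_for_sort)
  thus ?thesis using inj by (simp add: inj_map_eq_map)
qed

text \<open>
  Removing the zeros loses nothing, as their number is \<open>m\<close> minus the number of the other
  entries and their place in the chain is forced.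
\<close>
lemma bij_betw_chain_lists_partitions:
  "bij_betw (\<lambda>ys. filter_mset (\<lambda>x. x \<noteq> 0) (mset ys)) (chain_lists m \<delta>)
     {P \<in> chain_partitions (\<delta> :: 'k). size P \<le> m}"
  (is "bij_betw ?f ?L ?P")
proof (rule bij_betw_imageI)
  have split: "mset ys = ?f ys + replicate_mset (m - size (?f ys)) 0" if "length ys = m" for ys
  proof -
    have "mset ys = ?f ys + filter_mset (\<lambda>x. x = 0) (mset ys)"
      using multiset_partition[of "mset ys" "\<lambda>x. x \<noteq> 0"] by simp
    moreover have "filter_mset (\<lambda>x. x = 0) (mset ys) = replicate_mset (count (mset ys) 0) 0"
      using filter_eq_replicate_mset[of 0 "mset ys"] by (simp add: eq_commute)
    ultimately have eq: "mset ys = ?f ys + replicate_mset (count (mset ys) 0) 0" by simp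
    from arg_cong[OF this, of size] that have "count (mset ys) 0 = m - size (?f ys)" by simp
    with eq show ?thesis by simp
  qed
  show "inj_on ?f ?L"
  proof (rule inj_onI)
    fix xs ys assume "xs \<in> ?L" "ys \<in> ?L" and eq: "?f xs = ?f ys"
    hence *: "length xs = m" "length ys = m"
      "sorted_wrt (\<lambda>x y. y - x \<in> tp_integers0) xs" "sorted_wrt (\<lambda>x y. y - x \<in> tp_integers0) ys"
      by (auto simp: chain_lists_def)
    from split[OF *(1)] split[OF *(2)] have "mset xs = mset ys" unfolding eq by simp
    thus "xs = ys" using *(3,4) by (rule chain_list_unique)
  qed
  show "?f ` ?L = ?P"
  proof (intro equalityI subsetI)
    fix P assume "P \<in> ?f ` ?L"
    then obtain ys where ys: "ys \<in> ?L" and P: "P = ?f ys" by blast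
    define xs where "xs = filter (\<lambda>x. x \<noteq> 0) ys"
    have xs: "mset xs = P" by (simp add: xs_def P mset_filter)
    have "successively (\<lambda>x y. y - x \<in> tp_integers0) xs"
      using ys unfolding successively_conv_sorted_wrt[OF transp_tp_integers0]
      by (simp add: xs_def chain_lists_def sorted_wrt_filter)
    moreover have "set_mset P \<subseteq> tp_integers"
      using ys by (auto simp: P chain_lists_def tp_integers0_def)
    moreover have "size P \<le> m"
      using ys size_filter_mset_lesseq[of "\<lambda>x. x \<noteq> 0" "mset ys"] by (simp add: P chain_lists_def)
    moreover have "sum_mset P = \<delta>"
    proof -
      have "\<delta> = sum_mset (mset ys)" using ys by (simp add: chain_lists_def sum_mset_sum_list)
      also have "\<dots> = sum_mset P"
        using ys by (subst split) (simp_all add: P chain_lists_def sum_mset_replicate_mset)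
      finally show ?thesis by simp
    qed
    ultimately show "P \<in> ?P" using xs by (auto simp: chain_partitions_def partitions_def)
  next
    fix P assume "P \<in> ?P"
    then obtain xs where xs: "mset xs = P" "successively (\<lambda>x y. y - x \<in> tp_integers0) xs"
      and P: "set_mset P \<subseteq> tp_integers" "sum_mset P = \<delta>" "size P \<le> m"
      by (auto simp: chain_partitions_def partitions_def)
    define ys where "ys = replicate (m - length xs) 0 @ xs"
    have set: "set xs \<subseteq> tp_integers" using P(1) xs(1) by auto
    have len: "length xs \<le> m" using P(3) xs(1) by auto
    have "sorted_wrt (\<lambda>x y. y - x \<in> tp_integers0) xs"
      using xs(2) unfolding successively_conv_sorted_wrt[OF transp_tp_integers0] .
    moreover have "sorted_wrt (\<lambda>x y. y - x \<in> tp_integers0) (replicate n (0 :: 'k))" for n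
      by (simp add: sorted_wrt_iff_nth_less)
    ultimately have "sorted_wrt (\<lambda>x y. y - x \<in> tp_integers0) ys"
      using set by (auto simp: ys_def sorted_wrt_append tp_integers0_def)
    moreover have "sum_list ys = \<delta>"
      using P(2) xs(1) by (auto simp: ys_def sum_list_replicate simp flip: sum_mset_sum_list)
    ultimately have "ys \<in> ?L"
      using set len by (auto simp: ys_def chain_lists_def tp_integers0_def)
    moreover have "filter (\<lambda>x. x \<noteq> 0) ys = xs"
      using set zero_notin_tp_integers by (auto simp: ys_def filter_id_conv)
    hence "?f ys = P" using xs(1) by (simp flip: mset_filter)
    ultimately show "P \<in> ?f ` ?L" by blast
  qed
qed

lemma num_chain_partitions_upto_eq:
  "num_chain_partitions_upto m (\<delta> :: 'k) = card (weighted_solutions {1..m} \<delta>)"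
  unfolding num_chain_partitions_upto_def
  using bij_betw_same_card[OF bij_betw_tails] bij_betw_same_card[OF bij_betw_chain_lists_partitions]
  by metis

text \<open>
  Each unknown satisfies \<open>x i \<preceq> i * x i \<preceq> \<delta>\<close> because \<open>i \<ge> 1\<close>.
\<close>
lemma finite_weighted_solutions:
  assumes "finite J" "0 \<notin> J"
  shows "finite (weighted_solutions J (\<delta> :: 'k))"
proof (rule finite_subset)
  show "weighted_solutions J \<delta> \<subseteq> (\<Pi>\<^sub>E i\<in>J. tp_interval \<delta>)"
  proof
    fix x assume x: "x \<in> weighted_solutions J \<delta>"
    have "x i \<in> tp_interval \<delta>" if i: "i \<in> J" for i
    proof -
      have "\<delta> = of_nat i * x i + (\<Sum>j\<in>J - {i}. of_nat j * x j)"
        using x i assms(1) by (simp add: weighted_solutions_def sum.remove)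
      moreover have "of_nat i * x i = x i + of_nat (i - 1) * x i"
        using i assms(2) by (cases i) (auto simp: algebra_simps)
      moreover have "of_nat (i - 1) * x i + (\<Sum>j\<in>J - {i}. of_nat j * x j) \<in> tp_integers0"
        using x i by (intro tp_integers0_add tp_integers0_sum tp_integers0_of_nat_mult)
          (auto simp: weighted_solutions_def)
      ultimately have "\<delta> - x i \<in> tp_integers0" by simp
      thus ?thesis using x i by (auto simp: tp_interval_def weighted_solutions_def)
    qed
    with x show "x \<in> (\<Pi>\<^sub>E i\<in>J. tp_interval \<delta>)" by (auto simp: weighted_solutions_def PiE_iff)
  qed
qed (use assms finite_tp_interval in \<open>auto intro: finite_PiE\<close>)

lemma size_chain_partition_less:
  assumes "P \<in> chain_partitions \<delta>"
  shows "size P < card (tp_interval (\<delta> :: 'k))"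
  using size_less_card_tp_interval[of P 0] assms by (auto simp: chain_partitions_def partitions_def)

text \<open>
  Beyond \<open>N\<close> parts there are no chain partitions, and those with at most \<open>N\<close> parts
  correspond to the solutions of an equation.
\<close>
lemma finite_chain_partitions: "finite (chain_partitions (\<delta> :: 'k))"
proof -
  define N where "N = card (tp_interval \<delta>)"
  have "finite (chain_lists N \<delta>)"
    using bij_betw_finite[OF bij_betw_tails] finite_weighted_solutions[of "{1..N}" \<delta>] by auto
  hence "finite {P \<in> chain_partitions \<delta>. size P \<le> N}"
    using bij_betw_finite[OF bij_betw_chain_lists_partitions] by blast
  also have "{P \<in> chain_partitions \<delta>. size P \<le> N} = chain_partitions \<delta>"
    using size_chain_partition_less by (auto simp: N_def intro: less_imp_le)
  finally show ?thesis .
qed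

end

section \<open>The infinite product\<close>

lemma qsum_mult_eq_sum_tp_interval:
  "qsum_mult c d \<gamma> = (\<Sum>\<alpha>\<in>tp_interval \<gamma>. c \<alpha> * d (\<gamma> - \<alpha>))"
  unfolding qsum_mult_def
  by (rule sum.reindex_bij_witness[of _ "\<lambda>\<alpha>. (\<alpha>, \<gamma> - \<alpha>)" fst]) (auto simp: tp_interval_def)

context totally_real_field
begin

text \<open>
  Both sides sum over the decompositions \<open>\<gamma> = \<alpha> + \<beta> + \<eta>\<close>. This is what makes the fold
  in \<open>qsum_prod\<close> independent of the order of the factors.
\<close>
lemma qsum_mult_left_commute:
  "qsum_mult a (qsum_mult b c) = qsum_mult b (qsum_mult a (c :: 'k qsum))"
proof
  fix \<gamma> :: 'k
  have swap: "(\<alpha> \<in> tp_interval \<gamma> \<and> \<beta> \<in> tp_interval (\<gamma> - \<alpha>)) \<longleftrightarrow>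
      (\<beta> \<in> tp_interval \<gamma> \<and> \<alpha> \<in> tp_interval (\<gamma> - \<beta>))" (is "?L \<alpha> \<beta> \<longleftrightarrow> ?L \<beta> \<alpha>") for \<alpha> \<beta>
  proof -
    have "?L \<beta> \<alpha>" if "?L \<alpha> \<beta>" for \<alpha> \<beta>
      using that tp_integers0_add[of \<alpha> "\<gamma> - \<alpha> - \<beta>"] by (auto simp: tp_interval_def algebra_simps)
    thus ?thesis by blast
  qed
  have "qsum_mult a (qsum_mult b c) \<gamma> =
      (\<Sum>(\<alpha>, \<beta>)\<in>(SIGMA \<alpha>:tp_interval \<gamma>. tp_interval (\<gamma> - \<alpha>)). a \<alpha> * (b \<beta> * c (\<gamma> - \<alpha> - \<beta>)))"
    unfolding qsum_mult_eq_sum_tp_interval sum_distrib_left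
    by (subst sum.Sigma) (auto simp: finite_tp_interval)
  also have "\<dots> =
      (\<Sum>(\<beta>, \<alpha>)\<in>(SIGMA \<alpha>:tp_interval \<gamma>. tp_interval (\<gamma> - \<alpha>)). b \<beta> * (a \<alpha> * c (\<gamma> - \<beta> - \<alpha>)))"
    using swap
    by (intro sum.reindex_bij_witness[of _ prod.swap prod.swap]) (auto simp: algebra_simps)
  also have "\<dots> = qsum_mult b (qsum_mult a c) \<gamma>"
    unfolding qsum_mult_eq_sum_tp_interval sum_distrib_left
    by (subst sum.Sigma) (auto simp: finite_tp_interval)
  finally show "qsum_mult a (qsum_mult b c) \<gamma> = qsum_mult b (qsum_mult a c) \<gamma>" .
qed

lemma qsum_prod_insert:
  fixes f :: "'i \<Rightarrow> 'k qsum"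
  assumes "finite J" "j \<notin> J"
  shows "qsum_prod f (insert j J) = qsum_mult (f j) (qsum_prod f J)"
proof -
  interpret comp_fun_commute "\<lambda>i. qsum_mult (f i)"
    by standard (auto simp: fun_eq_iff intro: fun_cong[OF qsum_mult_left_commute])
  show ?thesis unfolding qsum_prod_def using assms by simp
qed

text \<open>
  Fixing \<open>x j = \<alpha>\<close> leaves an equation for \<open>\<gamma> - j * \<alpha>\<close>.
\<close>
lemma card_weighted_solutions_insert:
  assumes "finite J" "j \<notin> J" "0 \<notin> insert j J"
  shows "card (weighted_solutions (insert j J) (\<gamma> :: 'k)) =
     (\<Sum>\<alpha> | \<alpha> \<in> tp_integers0 \<and> of_nat j * \<alpha> \<in> tp_interval \<gamma>.
        card (weighted_solutions J (\<gamma> - of_nat j * \<alpha>)))"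
proof -
  define Q where "Q = {\<alpha> \<in> tp_integers0. of_nat j * \<alpha> \<in> tp_interval \<gamma>}"
  have "finite Q"
  proof (rule finite_imageD)
    show "finite ((\<lambda>\<alpha>. of_nat j * \<alpha>) ` Q)"
      by (rule finite_subset[OF _ finite_tp_interval[of \<gamma>]]) (auto simp: Q_def)
    show "inj_on (\<lambda>\<alpha>. of_nat j * \<alpha>) Q" using assms(3) by (auto simp: inj_on_def)
  qed
  have "bij_betw (\<lambda>(\<alpha>, x). x(j := \<alpha>)) (SIGMA \<alpha>:Q. weighted_solutions J (\<gamma> - of_nat j * \<alpha>))
     (weighted_solutions (insert j J) \<gamma>)"
  proof (rule bij_betw_byWitness[where f' = "\<lambda>x. (x j, x(j := undefined))"])
    have sum: "(\<Sum>i\<in>J. of_nat i * (if i = j then y else x i)) = (\<Sum>i\<in>J. of_nat i * x i)"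
      for x :: "nat \<Rightarrow> 'k" and y
      using assms(2) by (intro sum.cong) auto
    show "\<forall>p\<in>(SIGMA \<alpha>:Q. weighted_solutions J (\<gamma> - of_nat j * \<alpha>)).
        (\<lambda>x. (x j, x(j := undefined))) ((\<lambda>(\<alpha>, x). x(j := \<alpha>)) p) = p"
    proof
      fix p assume "p \<in> (SIGMA \<alpha>:Q. weighted_solutions J (\<gamma> - of_nat j * \<alpha>))"
      then obtain \<alpha> x where p: "p = (\<alpha>, x)" "x \<in> weighted_solutions J (\<gamma> - of_nat j * \<alpha>)" by blast
      hence "x j = undefined"
        using assms(2) PiE_arb[of x J "\<lambda>_. tp_integers0" j] by (simp add: weighted_solutions_def)
      thus "(\<lambda>x. (x j, x(j := undefined))) ((\<lambda>(\<alpha>, x). x(j := \<alpha>)) p) = p"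
        by (simp add: p fun_upd_idem)
    qed
    show "\<forall>x\<in>weighted_solutions (insert j J) \<gamma>. (\<lambda>(\<alpha>, x). x(j := \<alpha>)) (x j, x(j := undefined)) = x"
      by simp
    show "(\<lambda>(\<alpha>, x). x(j := \<alpha>)) ` (SIGMA \<alpha>:Q. weighted_solutions J (\<gamma> - of_nat j * \<alpha>))
        \<subseteq> weighted_solutions (insert j J) \<gamma>"
      using assms(1,2)
      by (auto simp: weighted_solutions_def Q_def PiE_iff extensional_def fun_upd_def sum algebra_simps)
    show "(\<lambda>x. (x j, x(j := undefined))) ` weighted_solutions (insert j J) \<gamma>
        \<subseteq> (SIGMA \<alpha>:Q. weighted_solutions J (\<gamma> - of_nat j * \<alpha>))"
    proof (intro image_subsetI SigmaI)
      fix x assume x: "x \<in> weighted_solutions (insert j J) \<gamma>"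
      have eq: "\<gamma> - of_nat j * x j = (\<Sum>i\<in>J. of_nat i * x i)"
        using x assms(1,2) by (simp add: weighted_solutions_def)
      also have "\<dots> \<in> tp_integers0"
        using x by (intro tp_integers0_sum tp_integers0_of_nat_mult) (auto simp: weighted_solutions_def)
      finally show "x j \<in> Q"
        using x by (auto simp: Q_def tp_interval_def weighted_solutions_def intro: tp_integers0_of_nat_mult)
      show "x(j := undefined) \<in> weighted_solutions J (\<gamma> - of_nat j * x j)"
        using x assms(2) eq
        by (auto simp: weighted_solutions_def PiE_iff extensional_def fun_upd_def sum)
    qed
  qed
  hence "card (weighted_solutions (insert j J) \<gamma>) =
      card (SIGMA \<alpha>:Q. weighted_solutions J (\<gamma> - of_nat j * \<alpha>))"
    by (simp add: bij_betw_same_card)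
  also have "\<dots> = (\<Sum>\<alpha>\<in>Q. card (weighted_solutions J (\<gamma> - of_nat j * \<alpha>)))"
    using assms \<open>finite Q\<close> by (intro card_SigmaI) (auto intro!: finite_weighted_solutions)
  finally show ?thesis by (simp add: Q_def)
qed

lemma qsum_prod_multiples:
  assumes "finite J" "0 \<notin> J"
  shows "qsum_prod multiples_qsum J (\<gamma> :: 'k) = real (card (weighted_solutions J \<gamma>))"
  using assms
proof (induction J arbitrary: \<gamma>)
  case empty
  have "weighted_solutions {} \<gamma> = (if \<gamma> = 0 then {\<lambda>_. undefined} else {})"
    by (auto simp: weighted_solutions_def)
  thus ?case by (simp add: qsum_prod_def qsum_one_def)
next
  case (insert j J)
  define m where "m \<alpha> = of_nat j * \<alpha>" for \<alpha> :: 'k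
  have inj: "inj_on m X" for X using insert.prems by (auto simp: m_def inj_on_def)
  have "qsum_prod multiples_qsum (insert j J) \<gamma> =
      (\<Sum>\<alpha>\<in>tp_interval \<gamma>. multiples_qsum j \<alpha> * real (card (weighted_solutions J (\<gamma> - \<alpha>))))"
    using insert by (simp add: qsum_prod_insert qsum_mult_eq_sum_tp_interval)
  also have "\<dots> = (\<Sum>\<alpha>\<in>tp_interval \<gamma> \<inter> m ` tp_integers0. real (card (weighted_solutions J (\<gamma> - \<alpha>))))"
    using finite_tp_interval
    by (intro sum.mono_neutral_cong_right) (auto simp: multiples_qsum_def m_def)
  also have "tp_interval \<gamma> \<inter> m ` tp_integers0 = m ` {\<alpha> \<in> tp_integers0. m \<alpha> \<in> tp_interval \<gamma>}"
    by auto
  also have "(\<Sum>\<alpha>\<in>\<dots>. real (card (weighted_solutions J (\<gamma> - \<alpha>)))) =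
      real (card (weighted_solutions (insert j J) \<gamma>))"
    unfolding sum.reindex[OF inj] using insert by (simp add: card_weighted_solutions_insert m_def)
  finally show ?case .
qed

text \<open>
  If \<open>x i\<close> were nonzero, \<open>i\<close> copies of it together with the remaining terms would add up to
  \<open>\<delta>\<close>, which is too many parts.
\<close>
lemma weighted_solution_large_index:
  assumes "x \<in> weighted_solutions J (\<delta> :: 'k)" "finite J" "i \<in> J" "card (tp_interval \<delta>) \<le> i"
  shows "x i = 0"
proof (rule ccontr)
  assume "x i \<noteq> 0"
  moreover have tp: "\<And>j. j \<in> J \<Longrightarrow> x j \<in> tp_integers0" using assms(1) by (auto simp: weighted_solutions_def)
  ultimately have "x i \<in> tp_integers" using assms(3) by (auto simp: tp_integers0_def)
  hence "set_mset (replicate_mset i (x i)) \<subseteq> tp_integers" by auto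
  moreover have "(\<Sum>j\<in>J - {i}. of_nat j * x j) \<in> tp_integers0"
    by (intro tp_integers0_sum tp_integers0_of_nat_mult tp) auto
  ultimately have "i < card (tp_interval (of_nat i * x i + (\<Sum>j\<in>J - {i}. of_nat j * x j)))"
    using size_less_card_tp_interval[of "replicate_mset i (x i)"] by (simp add: sum_mset_replicate_mset)
  also have "of_nat i * x i + (\<Sum>j\<in>J - {i}. of_nat j * x j) = \<delta>"
    using assms(1-3) by (simp add: weighted_solutions_def sum.remove)
  finally show False using assms(4) by simp
qed

text \<open>
  The unknowns with indices outside \<open>{1..card (tp_interval \<delta>)}\<close> all vanish, so
  restriction and extension by zero are mutually inverse.
\<close>
lemma card_weighted_solutions_stable:
  assumes J: "finite J" "{1..card (tp_interval \<delta>)} \<subseteq> J" "0 \<notin> J"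
  shows "card (weighted_solutions J (\<delta> :: 'k)) = card (weighted_solutions {1..card (tp_interval \<delta>)} \<delta>)"
proof -
  define N where "N = card (tp_interval \<delta>)"
  have N: "{1..N} \<subseteq> J" using J(2) by (simp add: N_def)
  have zero: "x i = 0" if "x \<in> weighted_solutions J \<delta>" "i \<in> J" "i \<notin> {1..N}" for x i
  proof -
    have "i \<noteq> 0" using that(2) J(3) by metis
    hence "N \<le> i" using that(3) by auto
    thus ?thesis using weighted_solution_large_index[OF that(1) J(1) that(2)] by (simp add: N_def)
  qed
  have "bij_betw (\<lambda>x. restrict x {1..N}) (weighted_solutions J \<delta>) (weighted_solutions {1..N} \<delta>)"
  proof (rule bij_betw_byWitness[where f' = "\<lambda>y. \<lambda>i\<in>J. if i \<in> {1..N} then y i else 0"])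
    show "\<forall>x\<in>weighted_solutions J \<delta>. (\<lambda>i\<in>J. if i \<in> {1..N} then restrict x {1..N} i else 0) = x"
    proof (intro ballI ext)
      fix x i assume x: "x \<in> weighted_solutions J \<delta>"
      show "(\<lambda>i\<in>J. if i \<in> {1..N} then restrict x {1..N} i else 0) i = x i"
      proof (cases "i \<in> J")
        case True
        then show ?thesis using zero[OF x True] by auto
      next
        case False
        then show ?thesis using x PiE_arb[of x J "\<lambda>_. tp_integers0" i] by (simp add: weighted_solutions_def)
      qed
    qed
    show "\<forall>y\<in>weighted_solutions {1..N} \<delta>. restrict (\<lambda>i\<in>J. if i \<in> {1..N} then y i else 0) {1..N} = y"
    proof (intro ballI ext)
      fix y i assume y: "y \<in> weighted_solutions {1..N} \<delta>"
      show "restrict (\<lambda>i\<in>J. if i \<in> {1..N} then y i else 0) {1..N} i = y i"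
      proof (cases "i \<in> {1..N}")
        case True
        then show ?thesis using N by auto
      next
        case False
        then show ?thesis using y PiE_arb[of y "{1..N}" "\<lambda>_. tp_integers0" i] by (simp add: weighted_solutions_def)
      qed
    qed
    show "(\<lambda>x. restrict x {1..N}) ` weighted_solutions J \<delta> \<subseteq> weighted_solutions {1..N} \<delta>"
    proof (intro image_subsetI)
      fix x assume x: "x \<in> weighted_solutions J \<delta>"
      have "\<delta> = (\<Sum>i\<in>J. of_nat i * x i)" using x by (simp add: weighted_solutions_def)
      also have "\<dots> = (\<Sum>i\<in>{1..N}. of_nat i * restrict x {1..N} i)"
        using J(1) N zero[OF x] by (intro sum.mono_neutral_cong_right) auto
      finally have "\<delta> = (\<Sum>i\<in>{1..N}. of_nat i * restrict x {1..N} i)" .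
      moreover have "restrict x {1..N} \<in> {1..N} \<rightarrow>\<^sub>E tp_integers0"
        using x N unfolding restrict_PiE_iff by (auto simp: weighted_solutions_def)
      ultimately show "restrict x {1..N} \<in> weighted_solutions {1..N} \<delta>"
        unfolding weighted_solutions_def by blast
    qed
    show "(\<lambda>y. \<lambda>i\<in>J. if i \<in> {1..N} then y i else 0) ` weighted_solutions {1..N} \<delta> \<subseteq> weighted_solutions J \<delta>"
    proof (intro image_subsetI)
      fix y assume y: "y \<in> weighted_solutions {1..N} \<delta>"
      define z where "z = (\<lambda>i\<in>J. if i \<in> {1..N} then y i else 0)"
      have "\<delta> = (\<Sum>i\<in>{1..N}. of_nat i * y i)" using y by (simp add: weighted_solutions_def)
      also have "\<dots> = (\<Sum>i\<in>J. of_nat i * z i)"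
        using J(1) N unfolding z_def by (intro sum.mono_neutral_cong_left) auto
      finally have "\<delta> = (\<Sum>i\<in>J. of_nat i * z i)" .
      moreover have "z \<in> J \<rightarrow>\<^sub>E tp_integers0"
        using y unfolding z_def restrict_PiE_iff by (auto simp: weighted_solutions_def)
      ultimately show "z \<in> weighted_solutions J \<delta>"
        unfolding weighted_solutions_def by blast
    qed
  qed
  thus ?thesis unfolding N_def by (rule bij_betw_same_card)
qed

lemma has_qsum_prod_multiples:
  "has_qsum_prod (multiples_qsum :: nat \<Rightarrow> 'k qsum) {1..} (\<lambda>\<delta>. real (num_chain_partitions \<delta>))"
  unfolding has_qsum_prod_def
proof
  fix \<delta> :: 'k
  define N where "N = card (tp_interval \<delta>)"
  have prod: "qsum_prod multiples_qsum J \<delta> = real (card (weighted_solutions {1..N} \<delta>))"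
    if "finite J" "{1..N} \<subseteq> J" "J \<subseteq> {1..}" for J
    using that card_weighted_solutions_stable[of J \<delta>]
    by (subst qsum_prod_multiples) (auto simp: N_def)
  have "{P \<in> chain_partitions \<delta>. size P \<le> N} = chain_partitions \<delta>"
    using size_chain_partition_less by (auto simp: N_def intro: less_imp_le)
  hence "num_chain_partitions \<delta> = card (weighted_solutions {1..N} \<delta>)"
    using num_chain_partitions_upto_eq[of N \<delta>]
    by (simp add: num_chain_partitions_def num_chain_partitions_upto_def)
  with prod show "\<exists>I. finite I \<and> I \<subseteq> {1..} \<and>
      (\<forall>J. finite J \<and> I \<subseteq> J \<and> J \<subseteq> {1..} \<longrightarrow>
        qsum_prod (multiples_qsum :: nat \<Rightarrow> 'k qsum) J \<delta> = qsum_prod multiples_qsum I \<delta>) \<and>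
      real (num_chain_partitions \<delta>) = qsum_prod (multiples_qsum :: nat \<Rightarrow> 'k qsum) I \<delta>"
    by (intro exI[of _ "{1..N}"]) auto
qed

end

theorem theorem5p1:
  assumes "number_field TYPE('k::field_char_0)"
    and "totally_real TYPE('k)"
  shows "(\<forall>\<delta> \<in> (tp_integers :: 'k set). \<forall>m \<ge> 1.
            finite (chain_partitions \<delta>) \<and>
            finite {x \<in> {1..m} \<rightarrow>\<^sub>E tp_integers0. \<delta> = (\<Sum>i=1..m. of_nat i * x i)} \<and>
            num_chain_partitions_upto m \<delta> =
              card {x \<in> {1..m} \<rightarrow>\<^sub>E tp_integers0. \<delta> = (\<Sum>i=1..m. of_nat i * x i)})
       \<and> has_qsum_prod (multiples_qsum :: nat \<Rightarrow> 'k qsum) {1..}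
            (\<lambda>\<delta>. real (num_chain_partitions \<delta>))"
proof -
  obtain B where "finite_dimensional_vector_space (\<lambda>(q::rat) (x::'k). of_rat q * x) B"
    using assms(1) unfolding number_field_def by blast
  then interpret totally_real_field B
    using assms(2) by (simp add: totally_real_field_def totally_real_field_axioms_def number_field_basis_def)
  show ?thesis
    using finite_chain_partitions finite_weighted_solutions num_chain_partitions_upto_eq
      has_qsum_prod_multiples
    unfolding weighted_solutions_def by auto
qed

end
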